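(* Let $M$ be a loopless matroid of rank $r = d+1$ on a finite ground set $E$. Let $\emptyset = F_0 \subsetneq F_1 \subsetneq \cdots \subsetneq F_k \subsetneq F_{k+1} = E$ be a chain of flats of $M$ with ranks $r_i := \operatorname{rk}_M F_i$, and let $d_1, \ldots, d_k$ be positive integers such that $\sum_{i=1}^k d_i = d$. Put $\widetilde d_i := \sum_{j=1}^i d_j$. Then the coefficient of $t_{F_1}^{d_1}\cdots t_{F_k}^{d_k}$ in the volume polynomial $VP_M(\underline t)$ is $$(-1)^{d-k}\binom{d}{d_1, \ldots, d_k} \prod_{i = 1}^{k} \binom{d_i - 1}{\widetilde d_i -r_i}\, \mu^{\widetilde d_i - r_i}(M|F_{i+1}/F_i).$$
   Context: For a loopless matroid $M$ on $E$ (i.e. $\emptyset$ is a flat), $\mathscr L_M$ is the lattice of flats and $\overline{\mathscr L_M} := \mathscr L_M\setminus\{\emptyset,E\}$. The Chow ring of $M$ is the graded ring $$A^\bullet(M) := \mathbb R[x_F : F\in \overline{\mathscr L_M}]/(\mathcal I_M+\mathcal J_M),$$ where $\mathcal I_M = (x_Fx_{F'} : F,F' \text{ incomparable})$ and $\mathcal J_M = (\sum_{F\ni i}x_F - \sum_{G\ni j}x_G : i,j\in E)$, sums over flats in $\overline{\mathscr L_M}$. If $M$ has rank $d+1$, then (known theorem of Adiprasito–Huh–Katz) there is a unique linear isomorphism $\deg_M: A^d(M)\to\mathbb R$ with $\deg_M(x_{G_1}x_{G_2}\cdots x_{G_d})=1$ for every maximal chain $G_1\subsetneq\cdots\subsetneq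 G_d$ in $\overline{\mathscr L_M}$. The volume polynomial of $M$ is $$VP_M(\underline t) := \deg_M\Big(\sum_{F\in\overline{\mathscr L_M}} x_Ft_F\Big)^d\in\mathbb R[t_F : F\in\overline{\mathscr L_M}],$$ where $\deg_M$ is extended linearly over $\mathbb R[t_F : F\in\overline{\mathscr L_M}]$. $M|F'/F$ denotes the restriction of $M$ to $F'$ followed by the contraction of $F$. For a loopless matroid $M'$ of rank at least $1$, the characteristic polynomial is $\chi_{M'}(t)=\sum_{G\in\mathscr L_{M'}}\mu(\emptyset,G)t^{\operatorname{rk}M'-\operatorname{rk}G}$ ($\mu(\cdot,\cdot)$ the Möbius function of $\mathscr L_{M'}$), the reduced characteristic polynomial is $\overline\chi_{M'}(t)=\chi_{M'}(t)/(t-1)$, and $\mu^i(M')$ is its $i$-th unsigned coefficient: $$\overline{\chi}_{M'}(t) = \mu^0(M') t^{\operatorname{rk} M'-1} - \mu^1(M') t^{\operatorname{rk}M'-2} + \cdots + (-1)^{\operatorname{rk}M' -1}\mu^{\operatorname{rk}M'-1}(M'),$$ with $\mu^i(M')=0$ for $i$ outside $0\le i\le \operatorname{rk}M'-1$. A binomial coefficient $\binom nm$ is zero if $m<0$ or $m>n$; $\binom{d}{d_1,\ldots,d_k}=d!/(d_1!\cdots d_k!)$. *)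

theory Defs
  imports
    "HOL-Algebra.QuotRing"
    "HOL-Computational_Algebra.Polynomial"
    "HOL-Library.Poly_Mapping"
begin

section \<open>Matroids and flats\<close>

record 'a pre_matroid =
  ground :: "'a set"
  indep :: "'a set \<Rightarrow> bool"

locale matroid =
  fixes M :: "'a pre_matroid"
  assumes finite_ground: "finite (ground M)"
    and indep_subset_ground: "indep M I \<Longrightarrow> I \<subseteq> ground M"
    and indep_empty: "indep M {}"
    and indep_subset: "indep M J \<Longrightarrow> I \<subseteq> J \<Longrightarrow> indep M I"
    and augmentation: "indep M I \<Longrightarrow> indep M J \<Longrightarrow> card I < card J
          \<Longrightarrow> \<exists>x\<in>J - I. indep M (insert x I)"

definition rk :: "'a pre_matroid \<Rightarrow> 'a set \<Rightarrow> nat" where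
  "rk M A = Max (card ` {I. I \<subseteq> A \<and> indep M I})"

abbreviation rank :: "'a pre_matroid \<Rightarrow> nat" where
  "rank M \<equiv> rk M (ground M)"

definition flat :: "'a pre_matroid \<Rightarrow> 'a set \<Rightarrow> bool" where
  "flat M F \<longleftrightarrow> F \<subseteq> ground M \<and> (\<forall>x\<in>ground M - F. rk M F < rk M (insert x F))"

definition flats :: "'a pre_matroid \<Rightarrow> 'a set set" where
  "flats M = {F. flat M F}"

definition proper_flats :: "'a pre_matroid \<Rightarrow> 'a set set" where
  "proper_flats M = flats M - {{}, ground M}"

definition loopless :: "'a pre_matroid \<Rightarrow> bool" where
  "loopless M \<longleftrightarrow> flat M {}"

definition restriction :: "'a pre_matroid \<Rightarrow> 'a set \<Rightarrow> 'a pre_matroid" where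
  "restriction M A = \<lparr>ground = ground M \<inter> A, indep = (\<lambda>I. I \<subseteq> A \<and> indep M I)\<rparr>"

definition basis_of :: "'a pre_matroid \<Rightarrow> 'a set \<Rightarrow> 'a set \<Rightarrow> bool" where
  "basis_of M A B \<longleftrightarrow> B \<subseteq> A \<and> indep M B \<and> (\<forall>x\<in>A - B. \<not> indep M (insert x B))"

definition contraction :: "'a pre_matroid \<Rightarrow> 'a set \<Rightarrow> 'a pre_matroid" where
  "contraction M A = \<lparr>ground = ground M - A,
     indep = (\<lambda>I. I \<subseteq> ground M - A \<and> (\<exists>B. basis_of M A B \<and> indep M (I \<union> B)))\<rparr>"

text \<open>\<open>minor M F' F\<close> is the matroid written $M|F'/F$.\<close>

definition minor :: "'a pre_matroid \<Rightarrow> 'a set \<Rightarrow> 'a set \<Rightarrow> 'a pre_matroid" where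
  "minor M F' F = contraction (restriction M F') F"


section \<open>Characteristic polynomials\<close>

text \<open>The Moebius function of a family \<open>L\<close> of finite sets ordered by inclusion, meaningful for
  arguments in \<open>L\<close>.\<close>

function moebius :: "'a set set \<Rightarrow> 'a set \<Rightarrow> 'a set \<Rightarrow> int" where
  "moebius L A B =
     (if A = B then 1
      else if finite B \<and> A \<subset> B then - (\<Sum>C\<in>{C \<in> L. A \<subseteq> C \<and> C \<subset> B}. moebius L A C)
      else 0)"
  by pat_completeness auto
termination
  by (relation "measure (\<lambda>(L, A, B). card B)") (auto intro: psubset_card_mono)

declare moebius.simps [simp del]

definition char_poly :: "'a pre_matroid \<Rightarrow> int poly" where
  "char_poly M =
     (\<Sum>G\<in>flats M. Polynomial.monom (moebius (flats M) {} G) (rank M - rk M G))"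

text \<open>For loopless matroids of positive rank the division is exact.\<close>

definition reduced_char_poly :: "'a pre_matroid \<Rightarrow> int poly" where
  "reduced_char_poly M = char_poly M div [:-1, 1:]"

definition mu_coeff :: "int \<Rightarrow> 'a pre_matroid \<Rightarrow> int" where
  "mu_coeff i M =
     (if 0 \<le> i \<and> i \<le> int (rank M) - 1
      then (-1) ^ nat i * Polynomial.coeff (reduced_char_poly M) (rank M - 1 - nat i)
      else 0)"

definition binom :: "nat \<Rightarrow> int \<Rightarrow> nat" where
  "binom n m = (if m < 0 then 0 else n choose nat m)"


section \<open>Chow rings\<close>

text \<open>Polynomials in variables indexed by \<open>'v\<close>: finitely supported functions from exponent vectors
  to coefficients.\<close>

type_synonym ('v, 'b) mpoly = "('v \<Rightarrow>\<^sub>0 nat) \<Rightarrow>\<^sub>0 'b"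

definition Const :: "'b \<Rightarrow> ('v, 'b::zero) mpoly" where
  "Const c = Poly_Mapping.single 0 c"

definition Var :: "'v \<Rightarrow> ('v, 'b::zero_neq_one) mpoly" where
  "Var v = Poly_Mapping.single (Poly_Mapping.single v 1) 1"

definition homogeneous :: "nat \<Rightarrow> ('v, 'b::zero) mpoly \<Rightarrow> bool" where
  "homogeneous n p \<longleftrightarrow>
     (\<forall>m\<in>Poly_Mapping.keys p. (\<Sum>v\<in>Poly_Mapping.keys m. Poly_Mapping.lookup m v) = n)"

definition mpoly_ring :: "'v set \<Rightarrow> ('v, 'b::comm_ring_1) mpoly ring" where
  "mpoly_ring V =
     \<lparr>carrier = {p. \<forall>m\<in>Poly_Mapping.keys p. Poly_Mapping.keys m \<subseteq> V},
      monoid.mult = (*), one = 1, zero = 0, add = (+)\<rparr>"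

abbreviation flat_ring :: "'a pre_matroid \<Rightarrow> ('a set, real) mpoly ring" where
  "flat_ring M \<equiv> mpoly_ring (proper_flats M)"

definition chow_I :: "'a pre_matroid \<Rightarrow> ('a set, real) mpoly set" where
  "chow_I M = genideal (flat_ring M)
     {Var F * Var F' | F F'. F \<in> proper_flats M \<and> F' \<in> proper_flats M \<and> \<not> F \<subseteq> F' \<and> \<not> F' \<subseteq> F}"

definition chow_J :: "'a pre_matroid \<Rightarrow> ('a set, real) mpoly set" where
  "chow_J M = genideal (flat_ring M)
     {(\<Sum>F\<in>{F \<in> proper_flats M. i \<in> F}. Var F) - (\<Sum>G\<in>{G \<in> proper_flats M. j \<in> G}. Var G)
      | i j. i \<in> ground M \<and> j \<in> ground M}"

definition chow_ideal :: "'a pre_matroid \<Rightarrow> ('a set, real) mpoly set" where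
  "chow_ideal M = chow_I M <+>\<^bsub>flat_ring M\<^esub> chow_J M"

definition chow_ring :: "'a pre_matroid \<Rightarrow> ('a set, real) mpoly set ring" where
  "chow_ring M = flat_ring M Quot chow_ideal M"

definition chow_class :: "'a pre_matroid \<Rightarrow> ('a set, real) mpoly \<Rightarrow> ('a set, real) mpoly set" where
  "chow_class M p = chow_ideal M +>\<^bsub>flat_ring M\<^esub> p"

definition chow_grade :: "'a pre_matroid \<Rightarrow> nat \<Rightarrow> ('a set, real) mpoly set set" where
  "chow_grade M n = chow_class M ` {p \<in> carrier (flat_ring M). homogeneous n p}"


section \<open>The degree map and the volume polynomial\<close>

text \<open>\<open>is_degree_map M f\<close>: on the top graded piece, \<open>f\<close> is an isomorphism of real vector spaces onto
  the reals, normalized to be 1 on the monomials of maximal chains. Scalars act on the Chow ring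
  through the classes of constant polynomials.\<close>

definition is_degree_map :: "'a pre_matroid \<Rightarrow> (('a set, real) mpoly set \<Rightarrow> real) \<Rightarrow> bool" where
  "is_degree_map M f \<longleftrightarrow>
     bij_betw f (chow_grade M (rank M - 1)) UNIV \<and>
     (\<forall>a\<in>chow_grade M (rank M - 1). \<forall>b\<in>chow_grade M (rank M - 1).
        f (a \<oplus>\<^bsub>chow_ring M\<^esub> b) = f a + f b) \<and>
     (\<forall>c. \<forall>a\<in>chow_grade M (rank M - 1).
        f (chow_class M (Const c) \<otimes>\<^bsub>chow_ring M\<^esub> a) = c * f a) \<and>
     (\<forall>C. subset.maxchain (proper_flats M) C \<longrightarrow> f (chow_class M (\<Prod>G\<in>C. Var G)) = 1)"

text \<open>Such a map is unique on the top graded piece, but not as a HOL function, since its values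
  elsewhere are arbitrary; hence \<open>SOME\<close> rather than \<open>THE\<close>.\<close>

definition degree_map :: "'a pre_matroid \<Rightarrow> ('a set, real) mpoly set \<Rightarrow> real" where
  "degree_map M = (SOME f. is_degree_map M f)"

text \<open>The power is formed for polynomials in the \<open>t\<^sub>F\<close> with coefficients in the polynomial ring in the
  \<open>x\<^sub>F\<close> (the inner \<open>Var F\<close>); the degree map is then applied to the class of each coefficient, all of
  which are homogeneous of degree \<open>rank M - 1\<close>.\<close>

definition volume_poly :: "'a pre_matroid \<Rightarrow> ('a set, real) mpoly" where
  "volume_poly M =
     Poly_Mapping.map (\<lambda>p. degree_map M (chow_class M p))
       ((\<Sum>F\<in>proper_flats M. Const (Var F) * Var F :: ('a set, ('a set, real) mpoly) mpoly)
          ^ (rank M - 1))"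

end

(* The formula itself defines a function "weight" on exponent vectors: zero off chains of total degree
   d, and otherwise the product of the signed factors binom * mu along the chain. Its linear extension
   kills the linear relations of the Chow ring, because by Weisner's theorem the sum of |mu(A,G)| over
   the flats G of fixed rank s + 1 in [A,B] containing (resp. avoiding) a given x in B - A is mu^s
   (resp. mu^(s+1)) of the minor, after which Pascal's rule makes the sum over all flats containing x
   telescope to a value independent of x. Conversely the top graded piece is spanned by alpha^d with
   alpha the sum of the x_F over F containing x, and alpha^d is the class of every maximal chain. Hence
   the linear extension is the degree map. *)

theory Submission
  imports Defs
begin

section \<open>Rank, closure and flats\<close>

context matroid
begin

text \<open>The weight of a monomial depends on each flat through its successor in the chain and
  through the degree accumulated below it. One more variable x_G therefore disturbs many factors at
  once: every flat above \<open>G\<close> has its index raised by one, and the flat just below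
  \<open>G\<close> gets a new successor. The sums stay tractable because a new \<open>G\<close> has
  exponent 1: its binomial is 0 or 1 and selects a single rank in the gap. On that rank the factor
  of the flat below is a last coefficient, a Moebius value up to sign, so Weisner's theorem applies.
  Existence of the degree map is obtained along the way. The functional is well defined on the
  quotient and equal to 1 on maximal chains, while the top graded piece is spanned by one class; so
  the functional induces an isomorphism there, and every map satisfying \<open>is_degree_map\<close>
  agrees with it. The multinomial coefficient of the formula comes solely from expanding the d-th
  power.\<close>

lemma indep_finite: "indep M I \<Longrightarrow> finite I"
  using finite_ground indep_subset_ground finite_subset by blast

lemma finite_indep_subsets: "finite {I. I \<subseteq> A \<and> indep M I}"
  by (rule finite_subset[of _ "Pow (ground M)"]) (auto simp: finite_ground dest: indep_subset_ground)

lemma card_le_rk: "I \<subseteq> A \<Longrightarrow> indep M I \<Longrightarrow> card I \<le> rk M A"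
  unfolding rk_def using finite_indep_subsets[of A] by (intro Max_ge) auto

lemma rk_le_iff: "rk M A \<le> n \<longleftrightarrow> (\<forall>I. I \<subseteq> A \<and> indep M I \<longrightarrow> card I \<le> n)"
  unfolding rk_def using finite_indep_subsets[of A] indep_empty by (subst Max_le_iff) auto

lemma ex_indep_rk: "\<exists>I. I \<subseteq> A \<and> indep M I \<and> card I = rk M A"
proof -
  have "rk M A \<in> card ` {I. I \<subseteq> A \<and> indep M I}"
    unfolding rk_def using finite_indep_subsets[of A] indep_empty by (intro Max_in) auto
  then show ?thesis by auto
qed

lemma rk_mono: "A \<subseteq> B \<Longrightarrow> rk M A \<le> rk M B"
  using card_le_rk[of _ B] by (subst rk_le_iff) blast

lemma rk_empty [simp]: "rk M {} = 0"
  using rk_le_iff[of "{}" 0] by auto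

text \<open>Augmentation from an independent set of maximal size raises \<open>card I\<close> by
  one, so induction on the deficit \<open>rk M A - card I\<close> reaches a basis of
  \<open>A\<close>.\<close>

lemma extend_indep:
  assumes "indep M I" "I \<subseteq> A"
  shows "\<exists>B. I \<subseteq> B \<and> B \<subseteq> A \<and> indep M B \<and> card B = rk M A"
  using assms
proof (induction "rk M A - card I" arbitrary: I rule: less_induct)
  case less
  have le: "card I \<le> rk M A" using less.prems card_le_rk by blast
  show ?case
  proof (cases "card I = rk M A")
    case True
    then show ?thesis using less.prems by blast
  next
    case False
    obtain J where J: "J \<subseteq> A" "indep M J" "card J = rk M A" using ex_indep_rk by blast
    then obtain x where x: "x \<in> J - I" "indep M (insert x I)"
      using augmentation[of I J] less.prems False le by auto
    have c: "card (insert x I) = Suc (card I)" using x indep_finite[OF less.prems(1)] by simp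
    have "\<exists>B. insert x I \<subseteq> B \<and> B \<subseteq> A \<and> indep M B \<and> card B = rk M A"
      by (rule less.hyps) (use x J less.prems c le False in auto)
    then show ?thesis by blast
  qed
qed

text \<open>This is the local form of submodularity: a point that depends on \<open>A\<close>
  depends on every larger set. Otherwise a basis of \<open>A\<close>, grown through \<open>B\<close>
  to \<open>insert x B\<close>, would have to pick up \<open>x\<close>, making \<open>x\<close>
  independent of that basis.\<close>

lemma rk_insert_eq_mono:
  assumes "rk M (insert x A) = rk M A" "A \<subseteq> B"
  shows "rk M (insert x B) = rk M B"
proof (rule ccontr)
  assume ne: "rk M (insert x B) \<noteq> rk M B"
  have gt: "rk M B < rk M (insert x B)" using ne rk_mono[OF subset_insertI[of B x]] by simp
  obtain I where I: "I \<subseteq> A" "indep M I" "card I = rk M A" using ex_indep_rk by blast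
  obtain J where J: "I \<subseteq> J" "J \<subseteq> B" "indep M J" "card J = rk M B"
    using extend_indep[OF I(2), of B] I assms(2) by blast
  obtain K where K: "J \<subseteq> K" "K \<subseteq> insert x B" "indep M K" "card K = rk M (insert x B)"
    using extend_indep[OF J(3), of "insert x B"] J by blast
  have "\<not> K \<subseteq> B" using K gt card_le_rk[of K B] by auto
  then have xK: "x \<in> K" "x \<notin> B" using K by auto
  have "indep M (insert x I)" by (rule indep_subset[OF K(3)]) (use xK J K in auto)
  then have "card (insert x I) \<le> rk M (insert x A)" using I by (intro card_le_rk) auto
  moreover have "card (insert x I) = Suc (card I)"
    using xK I assms(2) indep_finite[OF I(2)] by (subst card_insert_disjoint) auto
  ultimately show False using I assms by simp
qed

lemma rk_insert_le: "rk M (insert x A) \<le> Suc (rk M A)"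
proof -
  obtain I where I: "I \<subseteq> insert x A" "indep M I" "card I = rk M (insert x A)" using ex_indep_rk by blast
  have "card (I - {x}) \<le> rk M A" by (rule card_le_rk) (use I indep_subset[OF I(2)] in auto)
  moreover have "card I \<le> Suc (card (I - {x}))" using card_Suc_Diff1[of I x] indep_finite[OF I(2)]
    by (cases "x \<in> I") auto
  ultimately show ?thesis using I by simp
qed

lemma rk_Un_eq:
  assumes "finite X" "\<And>x. x \<in> X \<Longrightarrow> rk M (insert x A) = rk M A"
  shows "rk M (A \<union> X) = rk M A"
  using assms
proof (induction X rule: finite_induct)
  case (insert x X)
  have "rk M (insert x (A \<union> X)) = rk M (A \<union> X)"
    by (rule rk_insert_eq_mono[of _ A]) (use insert in auto)
  then show ?case using insert by simp
qed simp

section \<open>Closure and covers of flats\<close>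

definition cl :: "'a set \<Rightarrow> 'a set" where
  "cl A = {x \<in> ground M. rk M (insert x A) = rk M A}"

lemma subset_cl: "A \<subseteq> ground M \<Longrightarrow> A \<subseteq> cl A"
  unfolding cl_def by (auto simp: insert_absorb)

lemma rk_cl: assumes "A \<subseteq> ground M" shows "rk M (cl A) = rk M A"
proof -
  have "finite (cl A)" using finite_ground by (simp add: cl_def)
  then have "rk M (A \<union> cl A) = rk M A" by (rule rk_Un_eq) (simp add: cl_def)
  then show ?thesis using subset_cl[OF assms] by (simp add: Un_absorb1)
qed

lemma flat_iff: "flat M F \<longleftrightarrow> F \<subseteq> ground M \<and> (\<forall>x\<in>ground M. rk M (insert x F) = rk M F \<longrightarrow> x \<in> F)"
proof -
  have "rk M F < rk M (insert x F) \<longleftrightarrow> rk M (insert x F) \<noteq> rk M F" for x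
    using rk_mono[OF subset_insertI[of F x]] by auto
  then show ?thesis by (auto simp: flat_def)
qed

lemma flat_subset: "flat M F \<Longrightarrow> F \<subseteq> ground M"
  by (simp add: flat_def)

lemma flat_finite: "flat M F \<Longrightarrow> finite F"
  using flat_subset finite_ground finite_subset by blast

lemma flat_cl: assumes "A \<subseteq> ground M" shows "flat M (cl A)"
  unfolding flat_iff
proof (intro conjI ballI impI)
  show "cl A \<subseteq> ground M" by (auto simp: cl_def)
  fix x assume x: "x \<in> ground M" "rk M (insert x (cl A)) = rk M (cl A)"
  have "rk M (insert x A) \<le> rk M (insert x (cl A))" using subset_cl[OF assms] by (intro rk_mono) auto
  then have "rk M (insert x A) = rk M A"
    using x rk_cl[OF assms] rk_mono[OF subset_insertI[of A x]] by auto
  then show "x \<in> cl A" using x by (simp add: cl_def)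
qed

lemma cl_least: assumes "flat M G" "A \<subseteq> G" shows "cl A \<subseteq> G"
proof
  fix x assume "x \<in> cl A"
  then have x: "x \<in> ground M" "rk M (insert x A) = rk M A" by (auto simp: cl_def)
  have "rk M (insert x G) = rk M G" using rk_insert_eq_mono[OF x(2) assms(2)] .
  then show "x \<in> G" using assms(1) x by (auto simp: flat_iff)
qed

lemma flat_ground: "flat M (ground M)"
  by (simp add: flat_def)

lemma rk_flat_less: assumes "flat M F" "F \<subset> G" "G \<subseteq> ground M" shows "rk M F < rk M G"
proof -
  obtain x where x: "x \<in> G - F" using assms by blast
  have "rk M F < rk M (insert x F)" using assms x by (auto simp: flat_def)
  also have "\<dots> \<le> rk M G" using x assms by (intro rk_mono) auto
  finally show ?thesis .
qed

lemma flat_rk_eq: "flat M F \<Longrightarrow> F \<subseteq> G \<Longrightarrow> G \<subseteq> ground M \<Longrightarrow> rk M F = rk M G \<Longrightarrow> F = G"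
  using rk_flat_less[of F G] by auto

lemma rk_cl_insert:
  assumes "flat M F" "x \<in> ground M" "x \<notin> F"
  shows "rk M (cl (insert x F)) = Suc (rk M F)"
proof -
  have "rk M F < rk M (insert x F)" using assms by (auto simp: flat_def)
  then show ?thesis using rk_insert_le[of x F] assms flat_subset[of F] by (subst rk_cl) auto
qed

lemma insert_subset_cl_insert:
  assumes "flat M F" "x \<in> ground M" "x \<notin> F"
  shows "insert x F \<subseteq> cl (insert x F)"
  by (rule subset_cl) (use flat_subset assms in auto)

text \<open>Any flat containing \<open>F\<close> and \<open>x\<close> contains the closure, and
  equal rank forces equality. So each point outside \<open>F\<close> lies in exactly one flat
  covering \<open>F\<close>, which is behind both the regrouping of Moebius sums and the extension
  of flags.\<close>

lemma eq_cl_insert: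
  assumes "flat M F" "x \<notin> F" "flat M G" "insert x F \<subseteq> G" "rk M G = Suc (rk M F)"
  shows "G = cl (insert x F)"
proof -
  have x: "x \<in> ground M" using assms(3,4) flat_subset by blast
  have "cl (insert x F) \<subseteq> G" using assms by (intro cl_least) auto
  moreover have "rk M (cl (insert x F)) = rk M G" using rk_cl_insert[OF assms(1) x assms(2)] assms(5) by simp
  moreover have "flat M (cl (insert x F))" using x assms(1) flat_subset by (intro flat_cl) auto
  ultimately show ?thesis using flat_rk_eq[of "cl (insert x F)" G] assms(3) flat_subset by auto
qed

lemma finite_flats: "finite (flats M)"
  by (rule finite_subset[of _ "Pow (ground M)"]) (auto simp: flats_def finite_ground dest: flat_subset)

section \<open>Characteristic polynomials of intervals\<close>

definition interval :: "'a set \<Rightarrow> 'a set \<Rightarrow> 'a set set" where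
  "interval A B = {G. flat M G \<and> A \<subseteq> G \<and> G \<subseteq> B}"

lemma finite_interval: "finite (interval A B)"
  by (rule finite_subset[OF _ finite_flats]) (auto simp: interval_def flats_def)

abbreviation mob :: "'a set \<Rightarrow> 'a set \<Rightarrow> int" where
  "mob \<equiv> moebius (flats M)"

lemma mob_refl [simp]: "mob A A = 1"
  by (simp add: moebius.simps)

lemma sum_mob_interval:
  assumes "flat M B" "A \<subset> B"
  shows "(\<Sum>C\<in>interval A B. mob A C) = 0"
proof -
  have "interval A B = insert B {C \<in> flats M. A \<subseteq> C \<and> C \<subset> B}"
    using assms by (auto simp: interval_def flats_def)
  moreover have "mob A B = - (\<Sum>C\<in>{C \<in> flats M. A \<subseteq> C \<and> C \<subset> B}. mob A C)"
    using assms flat_finite[OF assms(1)] by (subst moebius.simps) auto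
  ultimately show ?thesis using finite_flats by simp
qed

text \<open>The flats between \<open>A\<close> and \<open>G\<close> are sorted by the closure of
  \<open>insert x H\<close>. The whole Moebius sum is zero because \<open>A\<close> is a proper
  subset of \<open>G\<close>, and the classes of smaller flats vanish by induction, so the class of
  \<open>G\<close> vanishes too.\<close>

lemma weisner:
  assumes "flat M G" "flat M A" "A \<subseteq> G" "x \<in> G" "x \<notin> A"
  shows "(\<Sum>H | H \<in> interval A G \<and> cl (insert x H) = G. mob A H) = 0"
  using assms
proof (induction "card G" arbitrary: G rule: less_induct)
  case less
  define S where "S G = (\<Sum>H | H \<in> interval A G \<and> cl (insert x H) = G. mob A H)" for G
  define T where "T = {G'. flat M G' \<and> A \<subseteq> G' \<and> x \<in> G' \<and> G' \<subseteq> G}"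
  have fT: "finite T" by (rule finite_subset[OF _ finite_flats]) (auto simp: T_def flats_def)
  have GT: "G \<in> T" using less.prems by (auto simp: T_def)
  have "0 = (\<Sum>H\<in>interval A G. mob A H)"
    using sum_mob_interval[of G A] less.prems by force
  also have "\<dots> = (\<Sum>G'\<in>T. \<Sum>H | H \<in> interval A G \<and> cl (insert x H) = G'. mob A H)"
  proof (rule sum.group[symmetric, OF finite_interval fT], safe)
    fix H assume H: "H \<in> interval A G"
    then have "insert x H \<subseteq> ground M" using less.prems flat_subset by (auto simp: interval_def)
    then show "cl (insert x H) \<in> T"
      using flat_cl[of "insert x H"] subset_cl[of "insert x H"] cl_least[of G "insert x H"] H less.prems
      by (auto simp: T_def interval_def)
  qed
  also have "\<dots> = (\<Sum>G'\<in>T. S G')"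
  proof (rule sum.cong[OF refl])
    fix G' assume G': "G' \<in> T"
    \<comment> \<open>Flats closing up to \<open>G'\<close> lie below \<open>G'\<close>, so the
      block can be computed in the interval up to \<open>G'\<close>, where the induction hypothesis
      speaks.\<close>
    have "{H. H \<in> interval A G \<and> cl (insert x H) = G'} = {H. H \<in> interval A G' \<and> cl (insert x H) = G'}"
    proof -
      have "H \<subseteq> G'" if "flat M H" "cl (insert x H) = G'" for H
        using subset_cl[of "insert x H"] that less.prems flat_subset by blast
      then show ?thesis using G' by (auto simp: interval_def T_def)
    qed
    then show "(\<Sum>H | H \<in> interval A G \<and> cl (insert x H) = G'. mob A H) = S G'" by (simp add: S_def)
  qed
  also have "\<dots> = S G + (\<Sum>G'\<in>T - {G}. S G')" using fT GT by (rule sum.remove)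
  also have "(\<Sum>G'\<in>T - {G}. S G') = 0"
  proof (rule sum.neutral, rule ballI)
    fix G' assume "G' \<in> T - {G}"
    then show "S G' = 0" unfolding S_def T_def using less.prems flat_finite[OF less.prems(1)]
      by (intro less.hyps) (auto intro!: psubset_card_mono)
  qed
  finally show ?case by (simp add: S_def)
qed

text \<open>Adding \<open>x\<close> raises the rank of a flat that misses it by exactly one. The
  flats whose closure with \<open>x\<close> is \<open>G\<close> are thus \<open>G\<close> and those
  of rank one less avoiding \<open>x\<close>, and Weisner's sum is solved for the term of
  \<open>G\<close>.\<close>

lemma mob_eq_sum_hyperplanes:
  assumes "flat M G" "flat M A" "A \<subseteq> G" "x \<in> G" "x \<notin> A"
  shows "mob A G = - (\<Sum>H | H \<in> interval A G \<and> x \<notin> H \<and> Suc (rk M H) = rk M G. mob A H)"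
proof -
  let ?U = "{H. H \<in> interval A G \<and> x \<notin> H \<and> Suc (rk M H) = rk M G}"
  have "{H. H \<in> interval A G \<and> cl (insert x H) = G} = insert G ?U"
  proof (intro Set.set_eqI iffI)
    fix H assume H: "H \<in> {H. H \<in> interval A G \<and> cl (insert x H) = G}"
    show "H \<in> insert G ?U"
    proof (cases "x \<in> H")
      case True
      then have "cl (insert x H) \<subseteq> H" using H by (intro cl_least) (auto simp: interval_def)
      then show ?thesis using H by (auto simp: interval_def)
    next
      case False
      then show ?thesis using H assms flat_subset[of G] by (auto simp: interval_def rk_cl_insert)
    qed
  next
    fix H assume H: "H \<in> insert G ?U"
    show "H \<in> {H. H \<in> interval A G \<and> cl (insert x H) = G}"
    proof (cases "H = G")
      case True
      then show ?thesis using assms subset_cl[of G] flat_subset[of G] cl_least[of G G]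
        by (auto simp: interval_def insert_absorb)
    next
      case False
      then show ?thesis using H assms eq_cl_insert[of H x G] by (auto simp: interval_def)
    qed
  qed
  moreover have "finite ?U" using finite_interval by simp
  moreover have "G \<notin> ?U" using assms by simp
  ultimately show ?thesis using weisner[OF assms] by simp
qed

text \<open>Each flat \<open>H\<close> avoiding \<open>x\<close> is charged to the single flat
  \<open>cl (insert x H)\<close>, one rank higher. The free function \<open>g\<close> of the rank
  allows two uses: powers of the variable give divisibility by t - 1, and rank indicators compare
  two formulas for a coefficient.\<close>

lemma sum_mob_containing:
  assumes "flat M A" "flat M B" "A \<subseteq> B" "x \<in> B" "x \<notin> A"
  shows "(\<Sum>G | G \<in> interval A B \<and> x \<in> G. mob A G * g (rk M G)) =
         - (\<Sum>H | H \<in> interval A B \<and> x \<notin> H. mob A H * g (Suc (rk M H)))"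
proof -
  let ?P = "{G. G \<in> interval A B \<and> x \<in> G}" and ?Q = "{H. H \<in> interval A B \<and> x \<notin> H}"
  have xg: "x \<in> ground M" using assms flat_subset by blast
  have "(\<Sum>G\<in>?P. mob A G * g (rk M G)) =
        (\<Sum>G\<in>?P. - (\<Sum>H | H \<in> ?Q \<and> cl (insert x H) = G. mob A H * g (Suc (rk M H))))"
  proof (rule sum.cong[OF refl])
    fix G assume G: "G \<in> ?P"
    have "mob A G = - (\<Sum>H | H \<in> interval A G \<and> x \<notin> H \<and> Suc (rk M H) = rk M G. mob A H)"
      using G assms by (intro mob_eq_sum_hyperplanes) (auto simp: interval_def)
    moreover have "{H. H \<in> interval A G \<and> x \<notin> H \<and> Suc (rk M H) = rk M G} = {H \<in> ?Q. cl (insert x H) = G}"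
      (is "?L = ?R")
    proof (intro Set.set_eqI iffI)
      fix H assume "H \<in> ?L"
      then show "H \<in> ?R" using G eq_cl_insert[of H x G] by (auto simp: interval_def)
    next
      fix H assume H: "H \<in> ?R"
      then have "H \<subseteq> G" using insert_subset_cl_insert[of H x] xg by (auto simp: interval_def)
      then show "H \<in> ?L" using H rk_cl_insert[of H x] xg by (auto simp: interval_def)
    qed
    ultimately have "mob A G = - (\<Sum>H | H \<in> ?Q \<and> cl (insert x H) = G. mob A H)" by simp
    then have "mob A G * g (rk M G) = - (\<Sum>H | H \<in> ?Q \<and> cl (insert x H) = G. mob A H * g (rk M G))"
      by (simp add: sum_distrib_right)
    also have "(\<Sum>H | H \<in> ?Q \<and> cl (insert x H) = G. mob A H * g (rk M G))
       = (\<Sum>H | H \<in> ?Q \<and> cl (insert x H) = G. mob A H * g (Suc (rk M H)))"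
      by (rule sum.cong) (auto simp: rk_cl_insert xg interval_def)
    finally show "mob A G * g (rk M G) =
        - (\<Sum>H | H \<in> ?Q \<and> cl (insert x H) = G. mob A H * g (Suc (rk M H)))" .
  qed
  also have "\<dots> = - (\<Sum>G\<in>?P. \<Sum>H | H \<in> ?Q \<and> cl (insert x H) = G. mob A H * g (Suc (rk M H)))"
    by (rule sum_negf)
  also have "(\<Sum>G\<in>?P. \<Sum>H | H \<in> ?Q \<and> cl (insert x H) = G. mob A H * g (Suc (rk M H)))
      = (\<Sum>H\<in>?Q. mob A H * g (Suc (rk M H)))"
  proof (rule sum.group)
    show "(\<lambda>H. cl (insert x H)) ` ?Q \<subseteq> ?P"
    proof safe
      fix H assume H: "H \<in> interval A B" "x \<notin> H"
      then show "x \<in> cl (insert x H)" using insert_subset_cl_insert[of H x] xg by (auto simp: interval_def)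
      show "cl (insert x H) \<in> interval A B"
        using H insert_subset_cl_insert[of H x] xg cl_least[of B "insert x H"] flat_cl[of "insert x H"] assms
          flat_subset[of H] by (auto simp: interval_def)
    qed
  qed (use finite_interval in auto)
  finally show ?thesis .
qed

section \<open>Rank, flats and Moebius function of minors\<close>

lemma ground_minor [simp]: "A \<subseteq> B \<Longrightarrow> B \<subseteq> ground M \<Longrightarrow> ground (minor M B A) = B - A"
  by (auto simp: minor_def contraction_def restriction_def)

text \<open>The maximal independent subsets of \<open>A\<close> are those of size
  \<open>rk M A\<close>, so the bases in the definition of contraction can be recognised by
  cardinality.\<close>

lemma indep_minor_iff:
  assumes "A \<subseteq> B" "B \<subseteq> ground M"
  shows "indep (minor M B A) I \<longleftrightarrow>
    I \<subseteq> B - A \<and> (\<exists>C. C \<subseteq> A \<and> indep M C \<and> card C = rk M A \<and> indep M (I \<union> C))"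
proof -
  have "basis_of (restriction M B) A C \<longleftrightarrow> C \<subseteq> A \<and> indep M C \<and> card C = rk M A" for C
  proof
    assume C: "basis_of (restriction M B) A C"
    then have C': "C \<subseteq> A" "indep M C" "\<And>x. x \<in> A - C \<Longrightarrow> \<not> indep M (insert x C)"
      using assms by (auto simp: basis_of_def restriction_def)
    obtain K where K: "C \<subseteq> K" "K \<subseteq> A" "indep M K" "card K = rk M A"
      using extend_indep[OF C'(2,1)] by blast
    have "K = C"
    proof (rule ccontr)
      assume "K \<noteq> C"
      then obtain x where x: "x \<in> K - C" using K by blast
      then have "indep M (insert x C)" using K by (intro indep_subset[OF K(3)]) auto
      then show False using C'(3)[of x] x K by blast
    qed
    then show "C \<subseteq> A \<and> indep M C \<and> card C = rk M A" using K by auto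
  next
    assume C: "C \<subseteq> A \<and> indep M C \<and> card C = rk M A"
    have "\<not> indep M (insert x C)" if "x \<in> A - C" for x
    proof
      assume "indep M (insert x C)"
      then have "card (insert x C) \<le> rk M A" using C that by (intro card_le_rk) auto
      then show False using C that indep_finite by auto
    qed
    then show "basis_of (restriction M B) A C"
      using C assms by (auto simp: basis_of_def restriction_def)
  qed
  moreover have "ground (restriction M B) = B"
    "indep (restriction M B) = (\<lambda>I. I \<subseteq> B \<and> indep M I)"
    using assms by (auto simp: restriction_def)
  ultimately have "indep (minor M B A) I \<longleftrightarrow> I \<subseteq> B - A \<and>
      (\<exists>C. (C \<subseteq> A \<and> indep M C \<and> card C = rk M A) \<and> I \<union> C \<subseteq> B \<and> indep M (I \<union> C))"
    by (simp add: minor_def contraction_def)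
  then show ?thesis using assms by blast
qed

text \<open>A basis \<open>C\<close> of \<open>A\<close> is extended to one of
  \<open>H \<union> A\<close>. By its size \<open>C\<close> is all that the extension has inside
  \<open>A\<close>; the rest lies in \<open>H\<close> and has the required size.\<close>

lemma rk_minor:
  assumes "A \<subseteq> B" "B \<subseteq> ground M" "H \<subseteq> B - A"
  shows "rk (minor M B A) H = rk M (H \<union> A) - rk M A"
  unfolding rk_def[of "minor M B A"]
proof (rule Max_eqI)
  have "finite H" using assms finite_ground finite_subset by (metis Diff_subset subset_trans)
  then show "finite (card ` {I. I \<subseteq> H \<and> indep (minor M B A) I})" by simp
  fix n assume "n \<in> card ` {I. I \<subseteq> H \<and> indep (minor M B A) I}"
  then obtain I C where I: "n = card I" "I \<subseteq> H" "C \<subseteq> A" "indep M C" "card C = rk M A" "indep M (I \<union> C)"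
    using assms by (auto simp: indep_minor_iff)
  have "card (I \<union> C) \<le> rk M (H \<union> A)" using I by (intro card_le_rk) auto
  moreover have "card (I \<union> C) = card I + card C"
    using I assms indep_finite[OF I(6)] by (intro card_Un_disjoint) auto
  ultimately show "n \<le> rk M (H \<union> A) - rk M A" using I by simp
next
  obtain C where C: "C \<subseteq> A" "indep M C" "card C = rk M A" using ex_indep_rk by blast
  obtain K where K: "C \<subseteq> K" "K \<subseteq> H \<union> A" "indep M K" "card K = rk M (H \<union> A)"
    using extend_indep[OF C(2), of "H \<union> A"] C by blast
  have "card (K \<inter> A) \<le> rk M A" using indep_subset[OF K(3)] by (intro card_le_rk) auto
  then have "C = K \<inter> A" using C K indep_finite[OF K(3)] by (intro card_seteq) auto
  then have "K - C \<subseteq> H" using K by auto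
  moreover have "indep (minor M B A) (K - C)"
    using C K \<open>K - C \<subseteq> H\<close> assms
    by (auto simp: indep_minor_iff Un_absorb2 intro!: exI[of _ C])
  moreover have "card (K - C) = rk M (H \<union> A) - rk M A"
    using C K indep_finite by (simp add: card_Diff_subset)
  ultimately show "rk M (H \<union> A) - rk M A \<in> card ` {I. I \<subseteq> H \<and> indep (minor M B A) I}"
    by (intro image_eqI[of _ _ "K - C"]) auto
qed

lemma flats_minor:
  assumes "flat M A" "flat M B" "A \<subseteq> B"
  shows "flats (minor M B A) = (\<lambda>G. G - A) ` interval A B"
proof -
  have BM: "B \<subseteq> ground M" using assms flat_subset by blast
  have rk: "rk (minor M B A) H = rk M (H \<union> A) - rk M A" if "H \<subseteq> B - A" for H
    using rk_minor[OF assms(3) BM that] .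
  have iff: "flat (minor M B A) H \<longleftrightarrow> flat M (H \<union> A)" if H: "H \<subseteq> B - A" for H
  proof -
    have lt: "rk (minor M B A) H < rk (minor M B A) (insert x H) \<longleftrightarrow>
      rk M (insert x (H \<union> A)) \<noteq> rk M (H \<union> A)" if x: "x \<in> B - A" for x
      using rk[OF H] rk[of "insert x H"] H x rk_mono[of A "H \<union> A"]
        rk_mono[OF subset_insertI[of "H \<union> A" x]] by auto
    show ?thesis
    proof
      assume L: "flat (minor M B A) H"
      show "flat M (H \<union> A)"
        unfolding flat_iff
      proof (intro conjI ballI impI)
        show "H \<union> A \<subseteq> ground M" using H assms BM by auto
        fix x assume x: "x \<in> ground M" "rk M (insert x (H \<union> A)) = rk M (H \<union> A)"
        \<comment> \<open>The minor only sees points of \<open>B\<close>. A point depending on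
          \<open>H \<union> A\<close> depends on \<open>B\<close> and hence lies in
          \<open>B\<close>, since \<open>B\<close> is a flat.\<close>
        have "rk M (insert x B) = rk M B" using rk_insert_eq_mono[OF x(2), of B] H assms by auto
        then have "x \<in> B" using assms(2) x by (auto simp: flat_iff)
        then show "x \<in> H \<union> A"
          using L lt[of x] x assms BM by (auto simp: flat_def)
      qed
    next
      assume R: "flat M (H \<union> A)"
      then have "\<forall>x\<in>B - A - H. rk M (insert x (H \<union> A)) \<noteq> rk M (H \<union> A)"
        using BM by (auto simp: flat_iff)
      then show "flat (minor M B A) H"
        using lt H assms BM by (auto simp: flat_def)
    qed
  qed
  show ?thesis
  proof (intro Set.set_eqI iffI)
    fix H assume "H \<in> flats (minor M B A)"
    then have H: "flat (minor M B A) H" by (simp add: flats_def)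
    then have "H \<subseteq> B - A" using assms BM by (auto simp: flat_def)
    then show "H \<in> (\<lambda>G. G - A) ` interval A B"
      using iff[of H] H assms by (intro image_eqI[of _ _ "H \<union> A"]) (auto simp: interval_def)
  next
    fix H assume "H \<in> (\<lambda>G. G - A) ` interval A B"
    then obtain G where G: "H = G - A" "flat M G" "A \<subseteq> G" "G \<subseteq> B" by (auto simp: interval_def)
    then have "H \<union> A = G" by auto
    then show "H \<in> flats (minor M B A)" using G iff[of H] by (auto simp: flats_def)
  qed
qed

text \<open>Removing \<open>A\<close> is an order isomorphism from the interval onto the flats of
  the minor, and the recursion defining the function is carried along it.\<close>

lemma moebius_minor:
  assumes "flat M A" "flat M B" "A \<subseteq> B" "G \<in> interval A B"
  shows "moebius (flats (minor M B A)) {} (G - A) = mob A G"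
  using assms(4)
proof (induction "card G" arbitrary: G rule: less_induct)
  case less
  have G: "flat M G" "A \<subseteq> G" "G \<subseteq> B" using less.prems by (auto simp: interval_def)
  have fin: "finite G" using flat_finite G by blast
  show ?case
  proof (cases "G = A")
    case True
    then show ?thesis by (simp add: moebius.simps)
  next
    case False
    let ?I = "{C \<in> flats M. A \<subseteq> C \<and> C \<subset> G}"
    have "{C \<in> flats (minor M B A). {} \<subseteq> C \<and> C \<subset> G - A} = (\<lambda>C. C - A) ` ?I"
    proof -
      have *: "C - A \<subset> G - A \<longleftrightarrow> C \<subset> G" if "A \<subseteq> C" for C using that G by blast
      show ?thesis unfolding flats_minor[OF assms(1-3)]
      proof (intro Set.set_eqI iffI)
        fix X assume "X \<in> {C \<in> (\<lambda>G. G - A) ` interval A B. {} \<subseteq> C \<and> C \<subset> G - A}"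
        then obtain C where "X = C - A" "C \<in> interval A B" "C - A \<subset> G - A" by auto
        then show "X \<in> (\<lambda>C. C - A) ` ?I" using *[of C] by (auto simp: interval_def flats_def)
      next
        fix X assume "X \<in> (\<lambda>C. C - A) ` ?I"
        then obtain C where "X = C - A" "C \<in> ?I" by auto
        then show "X \<in> {C \<in> (\<lambda>G. G - A) ` interval A B. {} \<subseteq> C \<and> C \<subset> G - A}"
          using *[of C] G by (auto simp: interval_def flats_def)
      qed
    qed
    moreover have "inj_on (\<lambda>C. C - A) ?I" by (auto simp: inj_on_def)
    ultimately have "(\<Sum>C\<in>{C \<in> flats (minor M B A). {} \<subseteq> C \<and> C \<subset> G - A}.
        moebius (flats (minor M B A)) {} C) = (\<Sum>C\<in>?I. moebius (flats (minor M B A)) {} (C - A))"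
      by (simp add: sum.reindex)
    also have "\<dots> = (\<Sum>C\<in>?I. mob A C)"
      using G fin by (intro sum.cong less.hyps) (auto simp: interval_def flats_def intro: psubset_card_mono)
    finally show ?thesis
      using False G fin by (subst (1 2) moebius.simps) auto
  qed
qed

lemma rk_interval: "G \<in> interval A B \<Longrightarrow> rk M A \<le> rk M G \<and> rk M G \<le> rk M B"
  by (auto simp: interval_def intro: rk_mono)

section \<open>Characteristic polynomials of minors and their coefficients\<close>

lemma char_poly_minor:
  assumes "flat M A" "flat M B" "A \<subseteq> B"
  shows "char_poly (minor M B A) = (\<Sum>G\<in>interval A B. Polynomial.monom (mob A G) (rk M B - rk M G))"
proof -
  have BM: "B \<subseteq> ground M" using assms flat_subset by blast
  have inj: "inj_on (\<lambda>G. G - A) (interval A B)" by (auto simp: inj_on_def interval_def)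
  have rank_eq: "rank (minor M B A) - rk (minor M B A) (G - A) = rk M B - rk M G" if "G \<in> interval A B" for G
  proof -
    have "rank (minor M B A) = rk M B - rk M A"
      using rk_minor[OF assms(3) BM, of "B - A"] assms BM by (simp add: Un_absorb2)
    moreover have "rk (minor M B A) (G - A) = rk M G - rk M A"
      using rk_minor[OF assms(3) BM, of "G - A"] that by (auto simp: interval_def Un_absorb2)
    ultimately show ?thesis using rk_interval[OF that] by auto
  qed
  have "char_poly (minor M B A) = (\<Sum>G\<in>interval A B.
      Polynomial.monom (moebius (flats (minor M B A)) {} (G - A)) (rank (minor M B A) - rk (minor M B A) (G - A)))"
    unfolding char_poly_def by (rule sum.reindex_cong[OF inj flats_minor[OF assms] refl])
  also have "\<dots> = (\<Sum>G\<in>interval A B. Polynomial.monom (mob A G) (rk M B - rk M G))"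
    by (rule sum.cong[OF refl]) (simp only: moebius_minor[OF assms] rank_eq)
  finally show ?thesis .
qed

text \<open>With \<open>g\<close> the power of t of exponent \<open>rk M B - r\<close>, the flats
  containing \<open>x\<close> contribute the negative of those avoiding \<open>x\<close>, with
  exponents lowered by one. The two halves combine to a factor t - 1.\<close>

lemma reduced_char_poly_minor:
  assumes "flat M A" "flat M B" "A \<subseteq> B" "x \<in> B" "x \<notin> A"
  shows "reduced_char_poly (minor M B A) =
    (\<Sum>G | G \<in> interval A B \<and> x \<notin> G. Polynomial.monom (mob A G) (rk M B - Suc (rk M G)))"
    (is "_ = ?Q")
proof -
  let ?P = "{G. G \<in> interval A B \<and> x \<in> G}" and ?N = "{G. G \<in> interval A B \<and> x \<notin> G}"
  let ?c = "\<lambda>n. Polynomial.monom (1::int) (rk M B - n)"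
  have less: "rk M G < rk M B" if "G \<in> ?N" for G
    using that assms flat_subset[of B] by (intro rk_flat_less) (auto simp: interval_def)
  have mm: "Polynomial.monom (mob A G) n = of_int (mob A G) * Polynomial.monom 1 n" for G n
    by (simp add: of_int_poly smult_monom)
  have "interval A B = ?P \<union> ?N" by auto
  then have "char_poly (minor M B A) =
      (\<Sum>G\<in>?P. of_int (mob A G) * ?c (rk M G)) + (\<Sum>G\<in>?N. of_int (mob A G) * ?c (rk M G))"
    unfolding char_poly_minor[OF assms(1-3)] mm using finite_interval[of A B]
    by (subst sum.union_disjoint[symmetric]) auto
  also have "(\<Sum>G\<in>?P. of_int (mob A G) * ?c (rk M G)) = - (\<Sum>G\<in>?N. of_int (mob A G) * ?c (Suc (rk M G)))"
  proof (rule poly_eqI)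
    fix n
    show "coeff (\<Sum>G\<in>?P. of_int (mob A G) * ?c (rk M G)) n =
      coeff (- (\<Sum>G\<in>?N. of_int (mob A G) * ?c (Suc (rk M G)))) n"
      using sum_mob_containing[OF assms, of "\<lambda>r. coeff (?c r) n"]
      by (simp add: Polynomial.coeff_sum of_int_poly)
  qed
  also have "\<dots> + (\<Sum>G\<in>?N. of_int (mob A G) * ?c (rk M G)) = [:-1, 1:] * ?Q"
  proof -
    have "[:-1, 1:] * ?Q = (\<Sum>G\<in>?N. of_int (mob A G) * ?c (rk M G) - of_int (mob A G) * ?c (Suc (rk M G)))"
      unfolding sum_distrib_left
    proof (rule sum.cong[OF refl])
      fix G assume "G \<in> ?N"
      \<comment> \<open>A flat avoiding \<open>x\<close> is proper in \<open>B\<close>, so the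
        exponent is positive and truncated subtraction loses nothing.\<close>
      then have "rk M B - rk M G = Suc (rk M B - Suc (rk M G))" using less by force
      then show "[:-1, 1:] * Polynomial.monom (mob A G) (rk M B - Suc (rk M G)) =
        of_int (mob A G) * ?c (rk M G) - of_int (mob A G) * ?c (Suc (rk M G))"
        by (simp add: of_int_poly smult_monom monom_Suc) (simp only: minus_monom)
    qed
    then show ?thesis by (simp add: sum_subtractf)
  qed
  finally have "char_poly (minor M B A) = [:-1, 1:] * ?Q" .
  then show ?thesis unfolding reduced_char_poly_def by (simp only:) (rule nonzero_mult_div_cancel_left, simp)
qed

text \<open>Coefficients are read off the quotient by t - 1, in which only flats avoiding the chosen
  \<open>x\<close> occur. Once \<open>s\<close> reaches the rank of the minor, no such flat is left
  and the coefficient is zero by convention.\<close>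

lemma mu_coeff_minor:
  assumes "flat M A" "flat M B" "A \<subseteq> B" "x \<in> B" "x \<notin> A"
  shows "mu_coeff (int s) (minor M B A) =
    (-1) ^ s * (\<Sum>G | G \<in> interval A B \<and> x \<notin> G \<and> rk M G = rk M A + s. mob A G)"
proof -
  have BM: "B \<subseteq> ground M" using assms flat_subset by blast
  let ?N = "{G. G \<in> interval A B \<and> x \<notin> G}"
  have less: "rk M A \<le> rk M G \<and> rk M G < rk M B" if "G \<in> ?N" for G
    using that assms flat_subset[of B] rk_interval[of G A B] rk_flat_less[of G B] by (auto simp: interval_def)
  have AB: "rk M A < rk M B" using assms BM by (intro rk_flat_less) auto
  have rank: "rank (minor M B A) = rk M B - rk M A"
    using rk_minor[OF assms(3) BM, of "B - A"] assms BM by (simp add: Un_absorb2)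
  show ?thesis
  proof (cases "s < rk M B - rk M A")
    case True
    have "coeff (reduced_char_poly (minor M B A)) (rk M B - rk M A - 1 - s) =
      (\<Sum>G\<in>?N. if rk M G = rk M A + s then mob A G else 0)"
      unfolding reduced_char_poly_minor[OF assms] Polynomial.coeff_sum
    proof (rule sum.cong[OF refl])
      fix G assume "G \<in> ?N"
      then have "rk M B - Suc (rk M G) = rk M B - rk M A - 1 - s \<longleftrightarrow> rk M G = rk M A + s"
        using less[of G] True by auto
      then show "coeff (Polynomial.monom (mob A G) (rk M B - Suc (rk M G))) (rk M B - rk M A - 1 - s) =
        (if rk M G = rk M A + s then mob A G else 0)" by simp
    qed
    also have "\<dots> = (\<Sum>G\<in>{G \<in> ?N. rk M G = rk M A + s}. mob A G)"
      using finite_interval by (intro sum.inter_filter[symmetric]) auto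
    also have "{G \<in> ?N. rk M G = rk M A + s} = {G. G \<in> interval A B \<and> x \<notin> G \<and> rk M G = rk M A + s}" by auto
    finally show ?thesis using True rank by (simp add: mu_coeff_def of_nat_diff)
  next
    case False
    then have "{G. G \<in> interval A B \<and> x \<notin> G \<and> rk M G = rk M A + s} = {}" using less by force
    then show ?thesis using False rank AB by (simp only: sum.empty) (auto simp: mu_coeff_def of_nat_diff)
  qed
qed

text \<open>The transfer between flats avoiding and containing \<open>x\<close>, with
  \<open>g\<close> the indicator of one rank, gives a second formula for the same coefficient,
  through flats one rank higher.\<close>

lemma mu_coeff_minor':
  assumes "flat M A" "flat M B" "A \<subseteq> B" "x \<in> B" "x \<notin> A"
  shows "mu_coeff (int s) (minor M B A) =
    (-1) ^ Suc s * (\<Sum>G | G \<in> interval A B \<and> x \<in> G \<and> rk M G = Suc (rk M A + s). mob A G)"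
proof -
  have *: "(\<Sum>G | G \<in> interval A B \<and> P G \<and> Q G. mob A G) =
      (\<Sum>G | G \<in> interval A B \<and> P G. mob A G * (if Q G then 1 else 0))" for P Q
  proof -
    have "{G. G \<in> interval A B \<and> P G \<and> Q G} = {G \<in> {G. G \<in> interval A B \<and> P G}. Q G}" by auto
    also have "(\<Sum>G\<in>\<dots>. mob A G) = (\<Sum>G | G \<in> interval A B \<and> P G. if Q G then mob A G else 0)"
      using finite_interval by (intro sum.inter_filter) auto
    finally show ?thesis by (simp add: if_distrib cong: if_cong)
  qed
  show ?thesis
    using sum_mob_containing[OF assms, of "\<lambda>r. if r = Suc (rk M A + s) then 1 else 0"]
    unfolding mu_coeff_minor[OF assms] * by simp
qed

text \<open>The only flat of full rank in the interval is \<open>G\<close>, so the last coefficient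
  is a Moebius value up to sign. Moebius sums over one rank thereby become sums of coefficients of
  minors.\<close>

lemma mu_coeff_minor_top:
  assumes "flat M A" "flat M G" "A \<subset> G" "rk M G = Suc (rk M A + s)"
  shows "mu_coeff (int s) (minor M G A) = (-1) ^ Suc s * mob A G"
proof -
  obtain x where x: "x \<in> G" "x \<notin> A" using assms by blast
  have "{H. H \<in> interval A G \<and> x \<in> H \<and> rk M H = Suc (rk M A + s)} = {G}"
    using assms x flat_rk_eq[of _ G] flat_subset[of G] by (auto simp: interval_def)
  then show ?thesis using mu_coeff_minor'[OF assms(1,2) _ x, of s] assms by simp
qed

lemma mu_coeff_minor_0:
  assumes "flat M A" "flat M B" "A \<subset> B"
  shows "mu_coeff 0 (minor M B A) = 1"
proof -
  obtain x where x: "x \<in> B" "x \<notin> A" using assms by blast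
  have "G = A" if "G \<in> interval A B" "rk M G = rk M A" for G
    using that assms(1) flat_rk_eq[of A G] flat_subset[of G] by (auto simp: interval_def)
  then have "{G. G \<in> interval A B \<and> x \<notin> G \<and> rk M G = rk M A + 0} = {A}"
    using assms x by (auto simp: interval_def)
  then show ?thesis using mu_coeff_minor[OF assms(1,2) _ x, of 0] assms by simp
qed

text \<open>Each summand is a last coefficient, so the sum is the formula through flats containing
  \<open>x\<close>. Excluding \<open>B\<close> matters only when \<open>B\<close> itself has the
  selected rank, and then no flat is left.\<close>

lemma sum_mu_coeff_containing:
  assumes "flat M A" "flat M B" "A \<subset> B" "x \<in> B" "x \<notin> A"
  shows "(\<Sum>G | flat M G \<and> A \<subset> G \<and> G \<subset> B \<and> x \<in> G \<and> rk M G = Suc (rk M A + s).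
       mu_coeff (int s) (minor M G A)) =
    (if rk M B = Suc (rk M A + s) then 0 else mu_coeff (int s) (minor M B A))"
proof (cases "rk M B = Suc (rk M A + s)")
  case True
  then have e: "{G. flat M G \<and> A \<subset> G \<and> G \<subset> B \<and> x \<in> G \<and> rk M G = Suc (rk M A + s)} = {}"
    using rk_flat_less[of _ B] flat_subset[OF assms(2)] by force
  show ?thesis unfolding e using True by simp
next
  case False
  have "{G. flat M G \<and> A \<subset> G \<and> G \<subset> B \<and> x \<in> G \<and> rk M G = Suc (rk M A + s)} =
    {G. G \<in> interval A B \<and> x \<in> G \<and> rk M G = Suc (rk M A + s)}"
    using False assms by (auto simp: interval_def)
  moreover have "mu_coeff (int s) (minor M G A) = (-1) ^ Suc s * mob A G"
    if "G \<in> {G. G \<in> interval A B \<and> x \<in> G \<and> rk M G = Suc (rk M A + s)}" for G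
    using that assms by (intro mu_coeff_minor_top) (auto simp: interval_def)
  ultimately show ?thesis using False assms mu_coeff_minor'[of A B x s]
    by (simp add: sum_distrib_left)
qed

text \<open>This is the formula through flats avoiding \<open>x\<close>, read at relative rank
  \<open>Suc s\<close>. Here \<open>B\<close> is already excluded by containing \<open>x\<close>, so
  no exceptional case arises.\<close>

lemma sum_mu_coeff_avoiding:
  assumes "flat M A" "flat M B" "A \<subset> B" "x \<in> B" "x \<notin> A"
  shows "(\<Sum>G | flat M G \<and> A \<subset> G \<and> G \<subset> B \<and> x \<notin> G \<and> rk M G = Suc (rk M A + s).
       mu_coeff (int s) (minor M G A)) = mu_coeff (int (Suc s)) (minor M B A)"
proof -
  have "{G. flat M G \<and> A \<subset> G \<and> G \<subset> B \<and> x \<notin> G \<and> rk M G = Suc (rk M A + s)} =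
    {G. G \<in> interval A B \<and> x \<notin> G \<and> rk M G = rk M A + Suc s}"
    using assms by (auto simp: interval_def)
  moreover have "mu_coeff (int s) (minor M G A) = (-1) ^ Suc s * mob A G"
    if "G \<in> {G. G \<in> interval A B \<and> x \<notin> G \<and> rk M G = rk M A + Suc s}" for G
    using that assms by (intro mu_coeff_minor_top) (auto simp: interval_def)
  ultimately show ?thesis using assms mu_coeff_minor[of A B x "Suc s"]
    by (simp add: sum_distrib_left)
qed

end

section \<open>Weights of monomials\<close>

lemma lookup_single_if: "Poly_Mapping.lookup (Poly_Mapping.single v c) w = (if v = w then c else 0)"
  by (simp add: lookup_single when_def)

lemma keys_add_single_nat:
  fixes m :: "'v \<Rightarrow>\<^sub>0 nat"
  shows "Poly_Mapping.keys (m + Poly_Mapping.single v (Suc 0)) = insert v (Poly_Mapping.keys m)"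
  by (auto simp: in_keys_iff lookup_add lookup_single_if split: if_splits)

lemma binom_zero: "binom 0 t = (if t = 0 then 1 else 0)"
  by (simp add: binom_def)

text \<open>The integer lower index makes the rule valid for every \<open>t\<close>; at
  \<open>t = -1\<close> it reads 1 = 0 + 1.\<close>

lemma binom_pascal: "0 < n \<Longrightarrow> binom n (t + 1) = binom (n - 1) t + binom (n - 1) (t + 1)"
proof -
  assume "0 < n"
  then obtain n' where n: "n = Suc n'" using gr0_implies_Suc by blast
  consider "t < -1" | "t = -1" | "t \<ge> 0" by linarith
  then show ?thesis
  proof cases
    case 3
    then have "nat (t + 1) = Suc (nat t)" by simp
    then show ?thesis using 3 n by (simp add: binom_def)
  qed (auto simp: binom_def)
qed

lemma binom_gt: "int n < t \<Longrightarrow> binom n t = 0"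
  by (auto simp: binom_def)

locale loopless_matroid = matroid +
  fixes d :: nat
  assumes flat_empty: "flat M {}"
    and rank_eq: "rank M = Suc d"
begin

section \<open>Chains of proper flats enumerated as flags\<close>

abbreviation E :: "'a set" where "E \<equiv> ground M"
abbreviation PF :: "'a set set" where "PF \<equiv> proper_flats M"
abbreviation expo :: "'a set \<Rightarrow> 'a set \<Rightarrow>\<^sub>0 nat" where "expo G \<equiv> Poly_Mapping.single G (Suc 0)"

lemma proper_flats_iff: "G \<in> PF \<longleftrightarrow> flat M G \<and> G \<noteq> {} \<and> G \<noteq> E"
  by (auto simp: proper_flats_def flats_def)

lemma finite_PF: "finite PF"
  by (simp add: proper_flats_def finite_flats)

lemma proper_flatD: "G \<in> PF \<Longrightarrow> flat M G \<and> {} \<subset> G \<and> G \<subset> E"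
  using flat_subset by (auto simp: proper_flats_iff)

text \<open>Both ends, \<open>{}\<close> and \<open>E\<close>, are included, so that the
  \<open>k\<close> proper flats bound \<open>k + 1\<close> gaps that can be treated
  uniformly.\<close>

definition flag :: "nat \<Rightarrow> (nat \<Rightarrow> 'a set) \<Rightarrow> bool" where
  "flag k F \<longleftrightarrow> F 0 = {} \<and> F (Suc k) = E \<and> (\<forall>i\<le>Suc k. flat M (F i)) \<and> (\<forall>i\<le>k. F i \<subset> F (Suc i))"

lemma flag_less: assumes "flag k F" "i < j" "j \<le> Suc k" shows "F i \<subset> F j"
  using assms(2,3)
proof (induction j)
  case (Suc j)
  have "F j \<subset> F (Suc j)" using assms(1) Suc by (auto simp: flag_def)
  moreover have "i = j \<or> F i \<subset> F j" using Suc by auto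
  ultimately show ?case by auto
qed simp

lemma flag_subset_iff: assumes "flag k F" "i \<le> Suc k" "j \<le> Suc k" shows "F i \<subseteq> F j \<longleftrightarrow> i \<le> j"
  using flag_less[OF assms(1), of i j] flag_less[OF assms(1), of j i] assms(2,3)
  by (cases i j rule: linorder_cases) auto

lemma flag_psubset_iff: assumes "flag k F" "i \<le> Suc k" "j \<le> Suc k" shows "F i \<subset> F j \<longleftrightarrow> i < j"
  using flag_subset_iff[OF assms] flag_subset_iff[OF assms(1,3,2)] by auto

lemma flag_eq_iff: assumes "flag k F" "i \<le> Suc k" "j \<le> Suc k" shows "F i = F j \<longleftrightarrow> i = j"
  using flag_subset_iff[OF assms] flag_subset_iff[OF assms(1,3,2)] by auto

lemma flag_inj_on: "flag k F \<Longrightarrow> inj_on F {..Suc k}"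
  by (rule inj_onI) (use flag_eq_iff in auto)

lemma flag_flat: "flag k F \<Longrightarrow> i \<le> Suc k \<Longrightarrow> flat M (F i)"
  by (auto simp: flag_def)

lemma flag_proper: assumes "flag k F" "1 \<le> i" "i \<le> k" shows "F i \<in> PF"
proof -
  have "F 0 = {}" "F (Suc k) = E" using assms(1) by (auto simp: flag_def)
  then show ?thesis
    using flag_eq_iff[OF assms(1), of i 0] flag_eq_iff[OF assms(1), of i "Suc k"] assms(2,3)
      flag_flat[OF assms(1), of i] by (simp add: proper_flats_iff)
qed

lemma flag_between:
  assumes "flag k F" "l \<le> k" "F l \<subset> G" "G \<subset> F (Suc l)" "j \<le> Suc k"
  shows "G \<subseteq> F j \<longleftrightarrow> l < j" "F j \<subseteq> G \<longleftrightarrow> j \<le> l" "G \<noteq> F j"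
proof (atomize(full), cases "j \<le> l")
  case True
  then have "F j \<subseteq> F l" using flag_subset_iff[OF assms(1), of j l] assms by simp
  then show "(G \<subseteq> F j \<longleftrightarrow> l < j) \<and> (F j \<subseteq> G \<longleftrightarrow> j \<le> l) \<and> G \<noteq> F j" using assms True by auto
next
  case False
  then have "F (Suc l) \<subseteq> F j" using flag_subset_iff[OF assms(1), of "Suc l" j] assms by simp
  then show "(G \<subseteq> F j \<longleftrightarrow> l < j) \<and> (F j \<subseteq> G \<longleftrightarrow> j \<le> l) \<and> G \<noteq> F j" using assms False by auto
qed

lemma chain_flag: "flag k F \<Longrightarrow> subset.chain PF (F ` {1..k})"
  unfolding subset_chain_def
proof (intro conjI ballI)
  assume f: "flag k F"
  show "F ` {1..k} \<subseteq> PF" using flag_proper[OF f] by auto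
  fix X Y assume "X \<in> F ` {1..k}" "Y \<in> F ` {1..k}"
  then obtain i j where ij: "X = F i" "Y = F j" "i \<le> Suc k" "j \<le> Suc k" by auto
  show "X \<subseteq> Y \<or> Y \<subseteq> X"
    using flag_subset_iff[OF f ij(3,4)] flag_subset_iff[OF f ij(4,3)] unfolding ij(1,2) by linarith
qed

lemma chain_finite: "subset.chain PF C \<Longrightarrow> finite C"
  using finite_PF finite_subset by (auto simp: subset_chain_def)

text \<open>Induction removes the largest member of the chain, which becomes the top of the shorter
  flag; for this \<open>P\<close> generalises the top \<open>E\<close> to an arbitrary flat
  \<open>U\<close>.\<close>

lemma ex_flag:
  assumes "subset.chain PF C"
  shows "\<exists>k F. flag k F \<and> C = F ` {1..k}"
proof -
  define P where "P U k F \<longleftrightarrow> F 0 = {} \<and> F (Suc k) = U \<and> (\<forall>i\<le>Suc k. flat M (F i)) \<and>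
    (\<forall>i\<le>k. F i \<subset> F (Suc i))" for U k and F :: "nat \<Rightarrow> 'a set"
  have "\<exists>k F. P U k F \<and> C = F ` {1..k}" if "flat M U" "U \<noteq> {}" "\<forall>G\<in>C. G \<subset> U" "subset.chain PF C" for U
    using chain_finite[OF that(4)] that
  proof (induction C arbitrary: U rule: finite_psubset_induct)
    case (psubset C)
    show ?case
    proof (cases "C = {}")
      case True
      then show ?thesis using psubset.prems flat_empty unfolding P_def
        by (intro exI[of _ 0] exI[of _ "\<lambda>i. if i = 0 then {} else U"]) auto
    next
      case False
      have C: "C \<subseteq> PF" "\<forall>X\<in>C. \<forall>Y\<in>C. X \<subseteq> Y \<or> Y \<subseteq> X"
        using psubset.prems(4) by (simp_all add: subset_chain_def)
      obtain V where V0: "V \<in> C" "\<forall>Y\<in>C. V \<subseteq> Y \<longrightarrow> V = Y"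
        using finite_has_maximal[OF psubset.hyps False] by blast
      then have V: "V \<in> C" "\<forall>Y\<in>C. Y \<subseteq> V" using C(2) by blast+
      have "V \<in> PF" using V C by blast
      then have Vf: "flat M V" "V \<noteq> {}" by (simp_all add: proper_flats_iff)
      have ch: "subset.chain PF (C - {V})" using C unfolding subset_chain_def by blast
      obtain k F where "P V k F" and CF: "C - {V} = F ` {1..k}"
        using psubset.IH[of "C - {V}" V] V Vf ch by blast
      then have F: "F 0 = {}" "F (Suc k) = V" "\<forall>i\<le>Suc k. flat M (F i)"
        "\<forall>i\<le>k. F i \<subset> F (Suc i)" by (simp_all add: P_def)
      have "C = (F(Suc (Suc k) := U)) ` {1..Suc k}"
      proof -
        have "(F(Suc (Suc k) := U)) ` {1..Suc k} = F ` {1..Suc k}" by (intro image_cong) auto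
        moreover have "F ` {1..Suc k} = insert V (F ` {1..k})" by (simp add: atLeastAtMostSuc_conv F(2))
        moreover have "C = insert V (F ` {1..k})" using CF V(1) by blast
        ultimately show ?thesis by simp
      qed
      moreover have "P U (Suc k) (F(Suc (Suc k) := U))"
        unfolding P_def
      proof (intro conjI allI impI)
        fix i assume "i \<le> Suc k"
        then show "(F(Suc (Suc k) := U)) i \<subset> (F(Suc (Suc k) := U)) (Suc i)"
          using F V(1) psubset.prems(3) by (cases "i = Suc k") simp_all
      qed (use F psubset.prems(1) in simp_all)
      ultimately show ?thesis by blast
    qed
  qed
  moreover have "E \<noteq> {}" using rank_eq by auto
  moreover have "\<forall>G\<in>C. G \<subset> E" using assms proper_flatD by (auto simp: subset_chain_def)
  ultimately show ?thesis using flat_ground assms unfolding flag_def P_def by simp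
qed

section \<open>Successors, cumulative degrees and weights\<close>

definition next_flat :: "'a set set \<Rightarrow> 'a set \<Rightarrow> 'a set" where
  "next_flat C G = \<Inter>{H \<in> insert E C. G \<subset> H}"

lemma next_flat_eqI:
  assumes "H \<in> insert E C" "G \<subset> H" "\<And>H'. H' \<in> insert E C \<Longrightarrow> G \<subset> H' \<Longrightarrow> H \<subseteq> H'"
  shows "next_flat C G = H"
  unfolding next_flat_def using assms by (intro Set.equalityI) (auto intro!: Inter_lower Inter_greatest)

definition cum_deg :: "('a set \<Rightarrow>\<^sub>0 nat) \<Rightarrow> 'a set \<Rightarrow> nat" where
  "cum_deg m G = (\<Sum>H | H \<in> PF \<and> H \<subseteq> G. Poly_Mapping.lookup m H)"

definition level :: "('a set \<Rightarrow>\<^sub>0 nat) \<Rightarrow> 'a set \<Rightarrow> int" where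
  "level m G = int (cum_deg m G) - int (rk M G)"

text \<open>The factor of the theorem at one flat: the exponent is d_i, \<open>level\<close> is the
  partial sum of degrees minus the rank, and \<open>next_flat\<close> is the successor in the chain,
  with \<open>E\<close> above the last flat. The global sign \<open>(-1)^(d - k)\<close> is split
  into one sign \<open>(-1)^(d_i - 1)\<close> per flat.\<close>

definition weight_factor :: "('a set \<Rightarrow>\<^sub>0 nat) \<Rightarrow> 'a set \<Rightarrow> real" where
  "weight_factor m G = (-1) ^ (Poly_Mapping.lookup m G - 1) * real (binom (Poly_Mapping.lookup m G - 1) (level m G))
     * of_int (mu_coeff (level m G) (minor M (next_flat (Poly_Mapping.keys m) G) G))"

text \<open>Including the bottom flat \<open>{}\<close> is harmless: its exponent is 0, truncated subtraction turns the
  binomial into \<open>binom 0 0\<close>, and its factor is 1.\<close>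

definition weight :: "('a set \<Rightarrow>\<^sub>0 nat) \<Rightarrow> real" where
  "weight m = (if subset.chain PF (Poly_Mapping.keys m) \<and> cum_deg m E = d
     then \<Prod>G\<in>insert {} (Poly_Mapping.keys m). weight_factor m G else 0)"

lemma cum_deg_add_single:
  "G \<in> PF \<Longrightarrow> cum_deg (m + expo G) H = cum_deg m H + (if G \<subseteq> H then 1 else 0)"
proof -
  assume G: "G \<in> PF"
  have "cum_deg (m + expo G) H = cum_deg m H + (\<Sum>K | K \<in> PF \<and> K \<subseteq> H. if G = K then Suc 0 else 0)"
    by (simp add: cum_deg_def lookup_add sum.distrib lookup_single_if)
  then show ?thesis using G finite_PF by (simp add: sum.delta)
qed

text \<open>The upper index is capped at \<open>k\<close> because the top \<open>F (Suc k)\<close>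
  is \<open>E\<close>, which is not in the support of \<open>m\<close>.\<close>

lemma cum_deg_flag:
  assumes "flag k F" "Poly_Mapping.keys m = F ` {1..k}" "j \<le> Suc k"
  shows "cum_deg m (F j) = (\<Sum>i=1..min j k. Poly_Mapping.lookup m (F i))"
proof -
  have "F ` {1..k} \<subseteq> PF" using chain_flag[OF assms(1)] by (simp add: subset_chain_def)
  moreover have "F ` {1..min j k} = {H \<in> F ` {1..k}. H \<subseteq> F j}"
  proof -
    have "F i \<subseteq> F j \<longleftrightarrow> i \<le> j" if "i \<le> k" for i
      using flag_subset_iff[OF assms(1) _ assms(3), of i] that by simp
    then have "{i \<in> {1..k}. F i \<subseteq> F j} = {1..min j k}" by (intro Set.set_eqI) (simp, blast)
    then show ?thesis by blast
  qed
  moreover have "H \<in> F ` {1..k}" if "0 < Poly_Mapping.lookup m H" for H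
    using that unfolding assms(2)[symmetric] by (simp add: in_keys_iff)
  ultimately have "cum_deg m (F j) = (\<Sum>H\<in>F ` {1..min j k}. Poly_Mapping.lookup m H)"
    unfolding cum_deg_def using finite_PF by (intro sum.mono_neutral_right) auto
  also have "\<dots> = (\<Sum>i=1..min j k. Poly_Mapping.lookup m (F i))"
  proof (subst sum.reindex)
    show "inj_on F {1..min j k}" by (rule inj_on_subset[OF flag_inj_on[OF assms(1)]]) auto
  qed simp
  finally show ?thesis .
qed

lemma prod_flag:
  assumes "flag k F"
  shows "(\<Prod>G\<in>insert {} (F ` {1..k}). f G) = (\<Prod>j\<le>k. f (F j))"
proof -
  have "{..k} = insert 0 {1..k}" by auto
  then have "insert {} (F ` {1..k}) = F ` {..k}" using assms by (auto simp: flag_def)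
  then show ?thesis using inj_on_subset[OF flag_inj_on[OF assms], of "{..k}"]
    by (simp add: prod.reindex)
qed

lemma next_flat_flag:
  assumes "flag k F" "j \<le> k"
  shows "next_flat (F ` {1..k}) (F j) = F (Suc j)"
proof (rule next_flat_eqI)
  have E: "F (Suc k) = E" using assms by (simp add: flag_def)
  then show "F (Suc j) \<in> insert E (F ` {1..k})" using assms by (cases "j = k") auto
  show "F j \<subset> F (Suc j)" using assms by (simp add: flag_def)
  fix H assume "H \<in> insert E (F ` {1..k})" "F j \<subset> H"
  moreover have "insert E (F ` {1..k}) \<subseteq> F ` {..Suc k}" unfolding E[symmetric] by auto
  ultimately have "\<exists>i\<le>Suc k. H = F i" by blast
  then obtain i where i: "H = F i" "i \<le> Suc k" by blast
  then have "j < i" using \<open>F j \<subset> H\<close> flag_psubset_iff[OF assms(1), of j i] assms(2) by simp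
  then show "F (Suc j) \<subseteq> H" using flag_subset_iff[OF assms(1), of "Suc j" i] i by simp
qed

end

text \<open>A monomial times a linear relation is a difference of sums of products of that monomial
  with single variables. Here \<open>m\<close> is such a monomial of degree d - 1 whose support is a
  chain, so a product of nonzero weight either raises one exponent or inserts one flat into a
  gap.\<close>

locale weighted_flag = loopless_matroid +
  fixes k :: nat and F :: "nat \<Rightarrow> 'a set" and m :: "'a set \<Rightarrow>\<^sub>0 nat"
  assumes flag: "flag k F"
    and keys_m: "Poly_Mapping.keys m = F ` {1..k}"
    and cum_deg_m: "Suc (cum_deg m E) = d"
begin

abbreviation ds :: "nat \<Rightarrow> nat" where "ds j \<equiv> Poly_Mapping.lookup m (F j)"
abbreviation s :: "nat \<Rightarrow> int" where "s j \<equiv> level m (F j)"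
abbreviation mu :: "nat \<Rightarrow> int \<Rightarrow> int" where "mu j t \<equiv> mu_coeff t (minor M (F (Suc j)) (F j))"

text \<open>\<open>a\<close> and \<open>b\<close> are the factors at \<open>F j\<close> of the weight of \<open>m\<close> multiplied by a variable lying above,
  respectively below, \<open>F j\<close>. The sum of the weights over the gap \<open>l\<close> is \<open>A l\<close> when restricted to flats
  containing a fixed point of the gap, and the telescoping is \<open>sum_h_step\<close>.\<close>

definition c :: "nat \<Rightarrow> real" where
  "c j = (-1) ^ (ds j - 1) * real (binom (ds j - 1) (s j))"
definition a :: "nat \<Rightarrow> real" where
  "a j = c j * of_int (mu j (s j))"
definition b :: "nat \<Rightarrow> real" where
  "b j = (-1) ^ (ds j - 1) * real (binom (ds j - 1) (s j + 1)) * of_int (mu j (s j + 1))"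
definition A :: "nat \<Rightarrow> real" where
  "A l = (\<Prod>j<Suc l. a j) * (\<Prod>j=Suc l..k. b j)"
definition h :: "'a set \<Rightarrow> real" where
  "h G = weight (m + expo G)"
definition gap :: "nat \<Rightarrow> 'a set set" where
  "gap l = {G. flat M G \<and> F l \<subset> G \<and> G \<subset> F (Suc l)}"

lemma F0 [simp]: "F 0 = {}" and FSk [simp]: "F (Suc k) = E"
  using flag by (auto simp: flag_def)

lemma ds_pos: "1 \<le> j \<Longrightarrow> j \<le> k \<Longrightarrow> 0 < ds j"
proof -
  assume "1 \<le> j" "j \<le> k"
  then have "F j \<in> Poly_Mapping.keys m" unfolding keys_m by simp
  then show ?thesis by (simp add: in_keys_iff)
qed

lemma cum_deg_F: "j \<le> k \<Longrightarrow> cum_deg m (F j) = (\<Sum>i=1..j. ds i)"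
  using cum_deg_flag[OF flag keys_m, of j] by (simp add: min_def)

lemma cum_deg_F_Suc: "j < k \<Longrightarrow> cum_deg m (F (Suc j)) = cum_deg m (F j) + ds (Suc j)"
  by (simp add: cum_deg_F)

lemma cum_deg_Fk: "cum_deg m (F k) = cum_deg m E"
  using cum_deg_flag[OF flag keys_m, of k] cum_deg_flag[OF flag keys_m, of "Suc k"] by simp

lemma s_0 [simp]: "s 0 = 0"
  using cum_deg_F[of 0] by (simp add: level_def)

lemma finite_gap: "finite (gap l)"
  by (rule finite_subset[OF _ finite_flats]) (auto simp: gap_def flats_def)

lemma gap_PF: assumes "l \<le> k" "G \<in> gap l" shows "G \<in> PF"
proof -
  have "F (Suc l) \<subseteq> E" using flag_subset_iff[OF flag, of "Suc l" "Suc k"] assms by simp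
  then show ?thesis using assms by (auto simp: gap_def proper_flats_iff)
qed

lemma gap_compare:
  assumes "l \<le> k" "G \<in> gap l" "j \<le> Suc k"
  shows "G \<subseteq> F j \<longleftrightarrow> l < j" "F j \<subseteq> G \<longleftrightarrow> j \<le> l" "G \<noteq> F j"
  using flag_between[OF flag assms(1) _ _ assms(3), of G] assms(2) by (auto simp: gap_def)

lemma elem_insert_E: "H \<in> insert E (F ` {1..k}) \<longleftrightarrow> (\<exists>j\<in>{1..Suc k}. H = F j)"
proof -
  have "{1..Suc k} = insert (Suc k) {1..k}" by auto
  then show ?thesis by auto
qed

lemma next_flat_gap:
  assumes "l \<le> k" "G \<in> gap l" "j \<le> k"
  shows "next_flat (insert G (F ` {1..k})) (F j) = (if j = l then G else F (Suc j))"
proof (rule next_flat_eqI)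
  have m: "H \<in> insert E (insert G (F ` {1..k})) \<longleftrightarrow> H = G \<or> (\<exists>j\<in>{1..Suc k}. H = F j)" for H
    using elem_insert_E[of H] by auto
  show "(if j = l then G else F (Suc j)) \<in> insert E (insert G (F ` {1..k}))"
    using assms unfolding m by auto
  show "F j \<subset> (if j = l then G else F (Suc j))"
    using flag assms by (auto simp: flag_def gap_def)
  fix H assume H: "H \<in> insert E (insert G (F ` {1..k}))" "F j \<subset> H"
  show "(if j = l then G else F (Suc j)) \<subseteq> H"
    using H(1) unfolding m
  proof (elim disjE bexE)
    assume "H = G"
    then show ?thesis using H(2) gap_compare[OF assms(1,2), of j] gap_compare[OF assms(1,2), of "Suc j"] assms by auto
  next
    fix i assume i: "i \<in> {1..Suc k}" "H = F i"
    then have "j < i" using H(2) flag_psubset_iff[OF flag, of j i] assms by auto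
    then show ?thesis using i gap_compare[OF assms(1,2), of i] flag_subset_iff[OF flag, of "Suc j" i] assms by auto
  qed
qed

lemma next_flat_gap_self:
  assumes "l \<le> k" "G \<in> gap l"
  shows "next_flat (insert G (F ` {1..k})) G = F (Suc l)"
proof (rule next_flat_eqI)
  have m: "H \<in> insert E (insert G (F ` {1..k})) \<longleftrightarrow> H = G \<or> (\<exists>j\<in>{1..Suc k}. H = F j)" for H
    using elem_insert_E[of H] by auto
  show "F (Suc l) \<in> insert E (insert G (F ` {1..k}))"
    using assms unfolding m by auto
  show "G \<subset> F (Suc l)" using assms by (auto simp: gap_def)
  fix H assume H: "H \<in> insert E (insert G (F ` {1..k}))" "G \<subset> H"
  then obtain i where i: "i \<in> {1..Suc k}" "H = F i" unfolding m by blast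
  then show "F (Suc l) \<subseteq> H" using H gap_compare[OF assms, of i] flag_subset_iff[OF flag, of "Suc l" i] assms by auto
qed

text \<open>Below the gap nothing changes; above it every cumulative degree grows by one, which
  turns the factors into \<open>b\<close>; \<open>F l\<close> keeps its binomial but has
  \<open>G\<close> as successor. The new flat has exponent 1, so its own factor only tests whether
  its level is zero.\<close>

lemma h_gap:
  assumes l: "l \<le> k" and G: "G \<in> gap l"
  shows "h G = (\<Prod>j<l. a j) * (c l * (if rk M G = Suc (cum_deg m (F l)) then of_int (mu_coeff (s l) (minor M G (F l))) else 0))
    * (\<Prod>j=Suc l..k. b j)"
proof -
  have GP: "G \<in> PF" using gap_PF[OF l G] .
  have ke: "Poly_Mapping.keys (m + expo G) = insert G (F ` {1..k})" by (simp add: keys_add_single_nat keys_m)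
  have "subset.chain PF (insert G (F ` {1..k}))"
    using chain_flag[OF flag] GP gap_compare[OF l G] by (force simp: subset_chain_def)
  moreover have "cum_deg (m + expo G) E = d"
    using cum_deg_m GP proper_flatD[OF GP] by (simp add: cum_deg_add_single) auto
  ultimately have "h G = (\<Prod>K\<in>insert G (insert {} (F ` {1..k})). weight_factor (m + expo G) K)"
    by (simp add: h_def weight_def ke insert_commute)
  also have "\<dots> = weight_factor (m + expo G) G * (\<Prod>K\<in>insert {} (F ` {1..k}). weight_factor (m + expo G) K)"
  proof (rule prod.insert)
    have "G \<noteq> F j" if "j \<le> k" for j using gap_compare(3)[OF l G, of j] that by simp
    from this[of 0] this show "G \<notin> insert {} (F ` {1..k})" by fastforce
  qed simp
  also have "(\<Prod>K\<in>insert {} (F ` {1..k}). weight_factor (m + expo G) K) = (\<Prod>j\<le>k. weight_factor (m + expo G) (F j))"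
    by (rule prod_flag[OF flag])
  also have "{..k} = {..<l} \<union> insert l {Suc l..k}" using l by auto
  also have "(\<Prod>j\<in>{..<l} \<union> insert l {Suc l..k}. weight_factor (m + expo G) (F j)) =
     (\<Prod>j<l. weight_factor (m + expo G) (F j)) * (weight_factor (m + expo G) (F l) * (\<Prod>j=Suc l..k. weight_factor (m + expo G) (F j)))"
    by (subst prod.union_disjoint) auto
  also have "(\<Prod>j<l. weight_factor (m + expo G) (F j)) = (\<Prod>j<l. a j)"
  proof (rule prod.cong[OF refl])
    fix j assume "j \<in> {..<l}"
    then show "weight_factor (m + expo G) (F j) = a j" using l gap_compare[OF l G, of j] next_flat_gap[OF l G, of j]
      by (simp add: weight_factor_def a_def c_def level_def lookup_add lookup_single_if cum_deg_add_single GP ke)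
  qed
  also have "(\<Prod>j=Suc l..k. weight_factor (m + expo G) (F j)) = (\<Prod>j=Suc l..k. b j)"
  proof (rule prod.cong[OF refl])
    fix j assume "j \<in> {Suc l..k}"
    then show "weight_factor (m + expo G) (F j) = b j" using l gap_compare[OF l G, of j] next_flat_gap[OF l G, of j]
      by (simp add: weight_factor_def b_def c_def level_def lookup_add lookup_single_if cum_deg_add_single GP ke algebra_simps)
  qed
  also have "weight_factor (m + expo G) (F l) = c l * of_int (mu_coeff (s l) (minor M G (F l)))"
    using l gap_compare[OF l G, of l] next_flat_gap[OF l G, of l]
    by (simp add: weight_factor_def c_def level_def lookup_add lookup_single_if cum_deg_add_single GP ke)
  \<comment> \<open>Exponent 1 leaves \<open>binom 0\<close>, the indicator of level zero, and at
    level zero the coefficient is the leading one, which is 1.\<close>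
  also have "weight_factor (m + expo G) G = (if rk M G = Suc (cum_deg m (F l)) then 1 else 0)"
  proof -
    have "G \<notin> Poly_Mapping.keys m"
    proof
      assume "G \<in> Poly_Mapping.keys m"
      then obtain j where "j \<le> k" "G = F j" by (auto simp: keys_m)
      then show False using gap_compare(3)[OF l G, of j] by simp
    qed
    then have lk: "Poly_Mapping.lookup m G = 0" by (simp add: in_keys_iff)
    \<comment> \<open>Since \<open>G\<close> lies in gap \<open>l\<close>, every flat of the support
      below \<open>G\<close> is already below \<open>F l\<close>.\<close>
    have "cum_deg m G = cum_deg m (F l)"
    proof -
      have "Poly_Mapping.lookup m H = 0" if "H \<subseteq> G" "\<not> H \<subseteq> F l" for H
      proof (rule ccontr)
        assume "Poly_Mapping.lookup m H \<noteq> 0"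
        then obtain j where "j \<in> {1..k}" "H = F j" using keys_m by (metis imageE in_keys_iff)
        then show False using that gap_compare[OF l G, of j] flag_subset_iff[OF flag, of j l] l by auto
      qed
      moreover have "F l \<subseteq> G" using G by (auto simp: gap_def)
      ultimately show ?thesis unfolding cum_deg_def using finite_PF
        by (intro sum.mono_neutral_right) auto
    qed
    then have lv: "level (m + expo G) G = 1 + int (cum_deg m (F l)) - int (rk M G)"
      by (simp add: level_def cum_deg_add_single GP)
    have "mu_coeff 0 (minor M (F (Suc l)) G) = 1"
      using G flag_flat[OF flag, of "Suc l"] l by (intro mu_coeff_minor_0) (auto simp: gap_def)
    then show ?thesis
      using next_flat_gap_self[OF l G] by (auto simp: weight_factor_def lookup_add lk lookup_single_if ke binom_zero lv)
  qed
  finally show ?thesis by simp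
qed

text \<open>Raising the exponent of \<open>F l\<close> flips its sign and raises both entries of the
  binomial. Pascal's rule splits the factor into \<open>b l\<close> and a term with the old binomial
  \<open>c l\<close>, which the gap above \<open>F l\<close> will cancel.\<close>

lemma h_F:
  assumes l: "1 \<le> l" "l \<le> k"
  shows "h (F l) = - ((\<Prod>j<l. a j) * (b l + c l * of_int (mu l (s l + 1))) * (\<Prod>j=Suc l..k. b j))"
proof -
  have GP: "F l \<in> PF" using flag_proper[OF flag l] .
  have ke: "Poly_Mapping.keys (m + expo (F l)) = F ` {1..k}" using l by (auto simp: keys_add_single_nat keys_m)
  have "cum_deg (m + expo (F l)) E = d"
    using cum_deg_m GP proper_flatD[OF GP] by (simp add: cum_deg_add_single) auto
  then have "h (F l) = (\<Prod>K\<in>insert {} (F ` {1..k}). weight_factor (m + expo (F l)) K)"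
    using chain_flag[OF flag] by (simp add: h_def weight_def ke)
  also have "\<dots> = (\<Prod>j\<le>k. weight_factor (m + expo (F l)) (F j))"
    by (rule prod_flag[OF flag])
  also have "{..k} = {..<l} \<union> insert l {Suc l..k}" using l by auto
  also have "(\<Prod>j\<in>{..<l} \<union> insert l {Suc l..k}. weight_factor (m + expo (F l)) (F j)) =
     (\<Prod>j<l. weight_factor (m + expo (F l)) (F j)) * (weight_factor (m + expo (F l)) (F l) * (\<Prod>j=Suc l..k. weight_factor (m + expo (F l)) (F j)))"
    by (subst prod.union_disjoint) auto
  also have "(\<Prod>j<l. weight_factor (m + expo (F l)) (F j)) = (\<Prod>j<l. a j)"
  proof (rule prod.cong[OF refl])
    fix j assume "j \<in> {..<l}"
    then show "weight_factor (m + expo (F l)) (F j) = a j"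
      using l flag_subset_iff[OF flag, of l j] flag_eq_iff[OF flag, of l j] next_flat_flag[OF flag, of j]
      by (simp add: weight_factor_def a_def c_def level_def lookup_add lookup_single_if cum_deg_add_single GP ke)
  qed
  also have "(\<Prod>j=Suc l..k. weight_factor (m + expo (F l)) (F j)) = (\<Prod>j=Suc l..k. b j)"
  proof (rule prod.cong[OF refl])
    fix j assume "j \<in> {Suc l..k}"
    then show "weight_factor (m + expo (F l)) (F j) = b j"
      using l flag_subset_iff[OF flag, of l j] flag_eq_iff[OF flag, of l j] next_flat_flag[OF flag, of j]
      by (simp add: weight_factor_def b_def c_def level_def lookup_add lookup_single_if cum_deg_add_single GP ke algebra_simps)
  qed
  also have "weight_factor (m + expo (F l)) (F l) = - (b l + c l * of_int (mu l (s l + 1)))"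
  proof -
    have p: "0 < ds l" using ds_pos l by simp
    then have sg: "(-1::real) ^ ds l = - ((-1) ^ (ds l - 1))" by (cases "ds l") auto
    have "weight_factor (m + expo (F l)) (F l) = (-1) ^ ds l * real (binom (ds l) (s l + 1)) * of_int (mu l (s l + 1))"
      using l next_flat_flag[OF flag, of l]
      by (simp add: weight_factor_def level_def lookup_add lookup_single_if cum_deg_add_single GP ke algebra_simps)
    then show ?thesis unfolding binom_pascal[OF p] sg b_def c_def by (simp add: algebra_simps)
  qed
  finally show ?thesis by (simp add: algebra_simps)
qed

lemma c_nonzeroD: "c l \<noteq> 0 \<Longrightarrow> s l \<ge> 0"
  by (auto simp: c_def binom_def split: if_splits)

lemma sum_h_gap:
  assumes l: "l \<le> k" and P: "P \<subseteq> gap l"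
  shows "(\<Sum>G\<in>P. h G) = (\<Prod>j<l. a j) *
     (c l * of_int (\<Sum>G | G \<in> P \<and> rk M G = Suc (cum_deg m (F l)). mu_coeff (s l) (minor M G (F l)))) * (\<Prod>j=Suc l..k. b j)"
proof -
  have fin: "finite P" using finite_gap P finite_subset by blast
  have "(\<Sum>G\<in>P. h G) = (\<Sum>G\<in>P. (\<Prod>j<l. a j) * (c l * (if rk M G = Suc (cum_deg m (F l))
      then of_int (mu_coeff (s l) (minor M G (F l))) else 0)) * (\<Prod>j=Suc l..k. b j))"
    using P by (intro sum.cong[OF refl] h_gap[OF l]) auto
  also have "\<dots> = (\<Prod>j<l. a j) * (c l * (\<Sum>G\<in>P. if rk M G = Suc (cum_deg m (F l))
      then of_int (mu_coeff (s l) (minor M G (F l))) else 0)) * (\<Prod>j=Suc l..k. b j)"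
    by (simp add: sum_distrib_left sum_distrib_right)
  also have "(\<Sum>G\<in>P. if rk M G = Suc (cum_deg m (F l)) then of_int (mu_coeff (s l) (minor M G (F l))) else 0)
     = (of_int (\<Sum>G\<in>{G \<in> P. rk M G = Suc (cum_deg m (F l))}. mu_coeff (s l) (minor M G (F l))) :: real)"
    unfolding of_int_sum by (rule sum.inter_filter[OF fin, symmetric])
  finally show ?thesis .
qed

text \<open>Only flats of rank one more than the cumulative degree at \<open>F l\<close> count. Over
  these the coefficients of the smaller minors add up to a coefficient of the whole interval, which
  completes the factor \<open>a l\<close>.\<close>

lemma sum_h_gap_in:
  assumes l: "l \<le> k" and x: "x \<in> F (Suc l)" "x \<notin> F l"
  shows "(\<Sum>G | G \<in> gap l \<and> x \<in> G. h G) = A l"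
proof (cases "c l = 0")
  case True
  then show ?thesis using l sum_h_gap[OF l, of "{G. G \<in> gap l \<and> x \<in> G}"] by (simp add: A_def a_def)
next
  case False
  then obtain n where n: "s l = int n" using c_nonzeroD nonneg_int_cases by blast
  then have cn: "cum_deg m (F l) = rk M (F l) + n" by (simp add: level_def)
  have fl: "flat M (F l)" "flat M (F (Suc l))" "F l \<subset> F (Suc l)"
    using l flag by (auto simp: flag_def)
  have "{G \<in> {G. G \<in> gap l \<and> x \<in> G}. rk M G = Suc (cum_deg m (F l))} =
     {G. flat M G \<and> F l \<subset> G \<and> G \<subset> F (Suc l) \<and> x \<in> G \<and> rk M G = Suc (rk M (F l) + n)}"
    by (auto simp: gap_def cn)
  then have eq: "(\<Sum>G | G \<in> gap l \<and> x \<in> G. h G) = (\<Prod>j<l. a j) * (c l * of_int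
      (if rk M (F (Suc l)) = Suc (rk M (F l) + n) then 0 else mu l (int n))) * (\<Prod>j=Suc l..k. b j)"
    using sum_h_gap[OF l, of "{G. G \<in> gap l \<and> x \<in> G}"] sum_mu_coeff_containing[OF fl x, of n]
    by (simp add: n)
  show ?thesis
  proof (cases "rk M (F (Suc l)) = Suc (rk M (F l) + n)")
    case True
    \<comment> \<open>In this exceptional case the sum is empty, so \<open>A l\<close> has to
      vanish. For \<open>l = k\<close> the rank of \<open>E\<close> would be \<open>d\<close>, a
      contradiction. Otherwise the level of \<open>F (Suc l)\<close> is one below its exponent, so
      the binomial in \<open>b (Suc l)\<close> has its lower entry above the upper one.\<close>
    have "l \<noteq> k" using True cn cum_deg_m cum_deg_Fk rank_eq by auto
    then have lk: "Suc l \<le> k" using l by simp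
    have "s (Suc l) + 1 = int (ds (Suc l))" using True cn cum_deg_F_Suc[of l] lk by (simp add: level_def)
    then have "b (Suc l) = 0" using ds_pos[of "Suc l"] lk by (simp add: b_def binom_gt)
    then have "(\<Prod>j=Suc l..k. b j) = 0" using lk by (intro prod_zero) auto
    then show ?thesis by (simp add: eq A_def)
  next
    case False
    then show ?thesis using eq by (simp add: A_def a_def n)
  qed
qed

lemma sum_h_gap_out:
  assumes l: "l \<le> k" and x: "x \<in> F (Suc l)" "x \<notin> F l"
  shows "(\<Sum>G | G \<in> gap l \<and> x \<notin> G. h G) =
    (\<Prod>j<l. a j) * (c l * of_int (mu l (s l + 1))) * (\<Prod>j=Suc l..k. b j)"
proof (cases "c l = 0")
  case True
  then show ?thesis using l sum_h_gap[OF l, of "{G. G \<in> gap l \<and> x \<notin> G}"] by simp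
next
  case False
  then obtain n where n: "s l = int n" using c_nonzeroD nonneg_int_cases by blast
  then have cn: "cum_deg m (F l) = rk M (F l) + n" by (simp add: level_def)
  have fl: "flat M (F l)" "flat M (F (Suc l))" "F l \<subset> F (Suc l)"
    using l flag by (auto simp: flag_def)
  have "{G \<in> {G. G \<in> gap l \<and> x \<notin> G}. rk M G = Suc (cum_deg m (F l))} =
     {G. flat M G \<and> F l \<subset> G \<and> G \<subset> F (Suc l) \<and> x \<notin> G \<and> rk M G = Suc (rk M (F l) + n)}"
    by (auto simp: gap_def cn)
  then show ?thesis
    using sum_h_gap[OF l, of "{G. G \<in> gap l \<and> x \<notin> G}"] sum_mu_coeff_avoiding[OF fl x, of n]
    by (simp only: n) (simp add: add.commute[of "int n" 1] del: of_int_sum)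
qed

text \<open>The gap is split at a point \<open>x\<close>. Flats avoiding \<open>x\<close> cancel the
  second term of \<open>h (F l)\<close>, flats containing \<open>x\<close> give \<open>A l\<close>,
  and the remaining term of \<open>h (F l)\<close> is \<open>- A (l - 1)\<close>, whose second
  product begins with \<open>b l\<close>.\<close>

lemma sum_h_step:
  assumes l: "1 \<le> l" "l \<le> k"
  shows "h (F l) + (\<Sum>G\<in>gap l. h G) = A l - A (l - 1)"
proof -
  obtain x where x: "x \<in> F (Suc l)" "x \<notin> F l" using flag l by (force simp: flag_def)
  have "(\<Sum>G\<in>gap l. h G) = (\<Sum>G | G \<in> gap l \<and> x \<in> G. h G) + (\<Sum>G | G \<in> gap l \<and> x \<notin> G. h G)"
    using finite_gap[of l] by (subst sum.union_disjoint[symmetric]) (auto intro: sum.cong)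
  moreover have "A (l - 1) = (\<Prod>j<l. a j) * b l * (\<Prod>j=Suc l..k. b j)"
    using l by (simp add: A_def prod.atLeast_Suc_atMost[of l k])
  ultimately show ?thesis
    by (simp add: sum_h_gap_in[OF l(2) x] sum_h_gap_out[OF l(2) x] h_F[OF l] algebra_simps)
qed

lemma h_comparable:
  assumes "h G \<noteq> 0" "j \<le> Suc k"
  shows "G \<subseteq> F j \<or> F j \<subseteq> G"
proof -
  have ch: "subset.chain PF (insert G (F ` {1..k}))"
    using assms(1) by (auto simp: h_def weight_def keys_add_single_nat keys_m split: if_splits)
  then have "G \<subseteq> E" using proper_flatD by (auto simp: subset_chain_def)
  consider "j = 0" | "j = Suc k" | "j \<in> {1..k}" using assms(2) by force
  then show ?thesis
  proof cases
    case 3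
    then show ?thesis using ch by (auto simp: subset_chain_def)
  qed (use \<open>G \<subseteq> E\<close> in auto)
qed

text \<open>Downward induction from the top, where no proper flat qualifies. A contributing flat
  above \<open>F (Suc l)\<close> is that flat, or lies in the next gap, or contains the next member,
  so each step adds one telescoping difference.\<close>

lemma sum_h_above:
  assumes "l \<le> k"
  shows "(\<Sum>G | G \<in> PF \<and> F (Suc l) \<subseteq> G. h G) = A k - A l"
  using assms
proof (induction l rule: inc_induct)
  case base
  have e: "{G. G \<in> PF \<and> F (Suc k) \<subseteq> G} = {}" using proper_flatD by auto
  show ?case unfolding e by simp
next
  case (step l)
  let ?U = "insert (F (Suc l)) (gap (Suc l)) \<union> {G. G \<in> PF \<and> F (Suc (Suc l)) \<subseteq> G}"
  have l: "Suc l \<le> k" using step by simp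
  have ss: "F (Suc l) \<subset> F (Suc (Suc l))" using flag l by (simp add: flag_def)
  have "(\<Sum>G | G \<in> PF \<and> F (Suc l) \<subseteq> G. h G) = (\<Sum>G\<in>?U. h G)"
  proof (rule sum.mono_neutral_right)
    show "finite {G. G \<in> PF \<and> F (Suc l) \<subseteq> G}" using finite_PF by simp
    show "?U \<subseteq> {G. G \<in> PF \<and> F (Suc l) \<subseteq> G}"
      using gap_PF[OF l] ss flag_proper[OF flag, of "Suc l"] l by (auto simp: gap_def)
    show "\<forall>G\<in>{G. G \<in> PF \<and> F (Suc l) \<subseteq> G} - ?U. h G = 0"
    proof (rule ballI, rule ccontr)
      fix G assume G: "G \<in> {G. G \<in> PF \<and> F (Suc l) \<subseteq> G} - ?U" "h G \<noteq> 0"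
      then show False using h_comparable[of G "Suc (Suc l)"] l proper_flatD[of G] by (auto simp: gap_def)
    qed
  qed
  also have "\<dots> = (\<Sum>G\<in>insert (F (Suc l)) (gap (Suc l)). h G) + (\<Sum>G | G \<in> PF \<and> F (Suc (Suc l)) \<subseteq> G. h G)"
    using finite_PF finite_gap ss by (intro sum.union_disjoint) (auto simp: gap_def)
  also have "(\<Sum>G\<in>insert (F (Suc l)) (gap (Suc l)). h G) = h (F (Suc l)) + (\<Sum>G\<in>gap (Suc l). h G)"
    using finite_gap by (intro sum.insert) (auto simp: gap_def)
  also have "\<dots> = A (Suc l) - A l" using sum_h_step[of "Suc l"] l by simp
  finally show ?case using step.IH by simp
qed

text \<open>With \<open>p\<close> the last index at which \<open>F p\<close> misses
  \<open>x\<close>, the contributing flats lie in gap \<open>p\<close> or contain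
  \<open>F (Suc p)\<close>. Their sums are \<open>A p\<close> and \<open>A k - A p\<close>, and the
  total has lost all trace of \<open>x\<close>.\<close>

lemma sum_weight_containing:
  assumes "x \<in> E"
  shows "(\<Sum>G | G \<in> PF \<and> x \<in> G. weight (m + expo G)) = A k"
proof -
  define q where "q = (LEAST q. x \<in> F q)"
  have xk: "x \<in> F (Suc k)" using assms by simp
  have q: "x \<in> F q" "q \<le> Suc k" unfolding q_def using LeastI[of "\<lambda>q. x \<in> F q", OF xk] Least_le[of "\<lambda>q. x \<in> F q", OF xk] by auto
  then obtain p where p: "q = Suc p" by (cases q) auto
  have np: "x \<notin> F p" using not_less_Least[of p "\<lambda>q. x \<in> F q"] p q_def by auto
  have pk: "p \<le> k" and xp: "x \<in> F (Suc p)" using q p by auto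
  let ?U = "{G. G \<in> gap p \<and> x \<in> G} \<union> {G. G \<in> PF \<and> F (Suc p) \<subseteq> G}"
  have "(\<Sum>G | G \<in> PF \<and> x \<in> G. h G) = (\<Sum>G\<in>?U. h G)"
  proof (rule sum.mono_neutral_right)
    show "finite {G. G \<in> PF \<and> x \<in> G}" using finite_PF by simp
    show "?U \<subseteq> {G. G \<in> PF \<and> x \<in> G}" using gap_PF[OF pk] xp by auto
    show "\<forall>G\<in>{G. G \<in> PF \<and> x \<in> G} - ?U. h G = 0"
    proof (rule ballI, rule ccontr)
      fix G assume G: "G \<in> {G. G \<in> PF \<and> x \<in> G} - ?U" "h G \<noteq> 0"
      then show False using h_comparable[of G "Suc p"] h_comparable[of G p] pk np proper_flatD[of G] by (auto simp: gap_def)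
    qed
  qed
  also have "\<dots> = (\<Sum>G | G \<in> gap p \<and> x \<in> G. h G) + (\<Sum>G | G \<in> PF \<and> F (Suc p) \<subseteq> G. h G)"
    using finite_PF finite_subset[OF _ finite_gap[of p], of "{G. G \<in> gap p \<and> x \<in> G}"] by (intro sum.union_disjoint) (auto simp: gap_def)
  finally show ?thesis using sum_h_gap_in[OF pk xp np] sum_h_above[OF pk] by (simp add: h_def)
qed

end

context loopless_matroid
begin

lemma sum_weight_containing_eq:
  assumes "x \<in> E" "y \<in> E"
  shows "(\<Sum>G | G \<in> PF \<and> x \<in> G. weight (m + expo G)) = (\<Sum>G | G \<in> PF \<and> y \<in> G. weight (m + expo G))"
proof (cases "subset.chain PF (Poly_Mapping.keys m) \<and> Suc (cum_deg m E) = d")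
  case True
  then obtain k F where "flag k F" "Poly_Mapping.keys m = F ` {1..k}"
    using ex_flag[of "Poly_Mapping.keys m"] by blast
  then interpret weighted_flag M d k F m using True by unfold_locales auto
  show ?thesis using sum_weight_containing assms by simp
next
  case False
  have "weight (m + expo G) = 0" if "G \<in> PF" for G
  proof (rule ccontr)
    assume "weight (m + expo G) \<noteq> 0"
    then have "subset.chain PF (insert G (Poly_Mapping.keys m))" "cum_deg (m + expo G) E = d"
      by (auto simp: weight_def keys_add_single_nat split: if_splits)
    then show False using False that proper_flatD[OF that] by (auto simp: subset_chain_def cum_deg_add_single)
  qed
  then show ?thesis by simp
qed

end

section \<open>Polynomial rings and linear extension\<close>

lemma carrier_mpoly_ring:
  "p \<in> carrier (mpoly_ring V) \<longleftrightarrow> (\<forall>m\<in>Poly_Mapping.keys p. Poly_Mapping.keys m \<subseteq> V)"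
  by (simp add: mpoly_ring_def)

lemma mpoly_ring_simps [simp]:
  "p \<otimes>\<^bsub>mpoly_ring V\<^esub> q = p * q" "p \<oplus>\<^bsub>mpoly_ring V\<^esub> q = p + q"
  "\<one>\<^bsub>mpoly_ring V\<^esub> = 1" "\<zero>\<^bsub>mpoly_ring V\<^esub> = 0"
  by (simp_all add: mpoly_ring_def)

lemma keys_uminus_gen: "Poly_Mapping.keys (- p) = Poly_Mapping.keys (p :: 'v \<Rightarrow>\<^sub>0 'b::ab_group_add)"
  by (auto simp: in_keys_iff)

lemma carrier_add: "p \<in> carrier (mpoly_ring V) \<Longrightarrow> q \<in> carrier (mpoly_ring V) \<Longrightarrow> p + q \<in> carrier (mpoly_ring V)"
  using keys_add[of p q] by (auto simp: carrier_mpoly_ring)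

lemma carrier_uminus: "p \<in> carrier (mpoly_ring V) \<Longrightarrow> - p \<in> carrier (mpoly_ring V)"
  by (simp add: carrier_mpoly_ring keys_uminus_gen)

lemma carrier_diff:
  fixes p q :: "('v, 'b::comm_ring_1) mpoly"
  shows "p \<in> carrier (mpoly_ring V) \<Longrightarrow> q \<in> carrier (mpoly_ring V) \<Longrightarrow> p - q \<in> carrier (mpoly_ring V)"
  using carrier_add[of p V "- q"] carrier_uminus[of q V] by simp

lemma carrier_mult:
  fixes p q :: "('v, 'b::comm_ring_1) mpoly"
  assumes "p \<in> carrier (mpoly_ring V)" "q \<in> carrier (mpoly_ring V)"
  shows "p * q \<in> carrier (mpoly_ring V)"
proof -
  have "Poly_Mapping.keys m \<subseteq> V" if m: "m \<in> Poly_Mapping.keys (p * q)" for m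
  proof -
    obtain a b where "m = a + b" "a \<in> Poly_Mapping.keys p" "b \<in> Poly_Mapping.keys q"
      using m keys_mult[of p q] by blast
    then show ?thesis using assms keys_add[of a b] by (fastforce simp: carrier_mpoly_ring)
  qed
  then show ?thesis by (simp add: carrier_mpoly_ring)
qed

lemma carrier_0: "0 \<in> carrier (mpoly_ring V)" and carrier_1: "1 \<in> carrier (mpoly_ring V)"
  by (simp_all add: carrier_mpoly_ring)

lemma carrier_single: "Poly_Mapping.keys m \<subseteq> V \<Longrightarrow> Poly_Mapping.single m c \<in> carrier (mpoly_ring V)"
  by (simp add: carrier_mpoly_ring)

lemma carrier_sum:
  "(\<And>i. i \<in> I \<Longrightarrow> p i \<in> carrier (mpoly_ring V)) \<Longrightarrow> sum p I \<in> carrier (mpoly_ring V)"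
proof (induction I rule: infinite_finite_induct)
  case (insert x I)
  then show ?case using carrier_add[of "p x" V "sum p I"] by simp
qed (simp_all add: carrier_0 carrier_1)

lemma carrier_prod:
  fixes p :: "'i \<Rightarrow> ('v, 'b::comm_ring_1) mpoly"
  shows "(\<And>i. i \<in> I \<Longrightarrow> p i \<in> carrier (mpoly_ring V)) \<Longrightarrow> prod p I \<in> carrier (mpoly_ring V)"
proof (induction I rule: infinite_finite_induct)
  case (insert x I)
  then show ?case using carrier_mult[of "p x" V "prod p I"] by simp
qed (simp_all add: carrier_0 carrier_1)

lemma carrier_power:
  fixes p :: "('v, 'b::comm_ring_1) mpoly"
  shows "p \<in> carrier (mpoly_ring V) \<Longrightarrow> p ^ n \<in> carrier (mpoly_ring V)"
proof (induction n)
  case (Suc n)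
  then show ?case using carrier_mult[of p V "p ^ n"] by simp
qed (simp add: carrier_1)

lemma carrier_Var: "v \<in> V \<Longrightarrow> Var v \<in> carrier (mpoly_ring V)"
  by (simp add: carrier_mpoly_ring Var_def)

lemma carrier_Const: "Const c \<in> carrier (mpoly_ring V)"
  by (simp add: carrier_mpoly_ring Const_def)

lemma cring_mpoly_ring: "cring (mpoly_ring V :: ('v, 'b::comm_ring_1) mpoly ring)"
proof (rule cringI)
  show "abelian_group (mpoly_ring V :: ('v, 'b) mpoly ring)"
  proof (rule abelian_groupI)
    fix x :: "('v, 'b) mpoly" assume "x \<in> carrier (mpoly_ring V)"
    then show "\<exists>y\<in>carrier (mpoly_ring V). y \<oplus>\<^bsub>mpoly_ring V\<^esub> x = \<zero>\<^bsub>mpoly_ring V\<^esub>"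
      using carrier_uminus[of x V] by (intro bexI[of _ "- x"]) simp_all
  qed (simp_all add: carrier_0 carrier_add ac_simps)
  show "comm_monoid (mpoly_ring V :: ('v, 'b) mpoly ring)"
    by (rule comm_monoidI) (simp_all add: carrier_1 carrier_mult ac_simps)
qed (simp add: distrib_right)

lemma uminus_mpoly_ring:
  fixes p :: "('v, 'b::comm_ring_1) mpoly"
  assumes "p \<in> carrier (mpoly_ring V)"
  shows "\<ominus>\<^bsub>mpoly_ring V\<^esub> p = - p"
proof -
  interpret cring "mpoly_ring V :: ('v, 'b) mpoly ring" by (rule cring_mpoly_ring)
  show ?thesis using assms carrier_uminus[OF assms] by (intro minus_equality) simp_all
qed

lemma minus_mpoly_ring:
  fixes p :: "('v, 'b::comm_ring_1) mpoly"
  assumes "q \<in> carrier (mpoly_ring V)"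
  shows "p \<ominus>\<^bsub>mpoly_ring V\<^esub> q = p - q"
  using uminus_mpoly_ring[OF assms] by (simp add: a_minus_def)

lemma sum_singles:
  assumes "finite S" "Poly_Mapping.keys p \<subseteq> S"
  shows "(\<Sum>m\<in>S. Poly_Mapping.single m (Poly_Mapping.lookup p m)) = p"
proof (rule poly_mapping_eqI)
  fix n
  have "Poly_Mapping.lookup (\<Sum>m\<in>S. Poly_Mapping.single m (Poly_Mapping.lookup p m)) n =
    (\<Sum>m\<in>S. if m = n then Poly_Mapping.lookup p n else 0)"
    by (auto simp: lookup_sum lookup_single_if intro: sum.cong)
  also have "\<dots> = Poly_Mapping.lookup p n"
    using assms by (auto simp: sum.delta in_keys_iff)
  finally show "Poly_Mapping.lookup (\<Sum>m\<in>S. Poly_Mapping.single m (Poly_Mapping.lookup p m)) n =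
    Poly_Mapping.lookup p n" .
qed

lemma mpoly_eq_sum_singles:
  "p = (\<Sum>m\<in>Poly_Mapping.keys p. Poly_Mapping.single m (Poly_Mapping.lookup p m))"
  using sum_singles[of "Poly_Mapping.keys p" p] by simp

lemma Const_mult_single: "Const c * Poly_Mapping.single m e = Poly_Mapping.single m (c * e)"
  by (simp add: Const_def mult_single)

lemma single_mult_Var:
  "Poly_Mapping.single m (c :: 'b::comm_ring_1) * Var v = Poly_Mapping.single (m + Poly_Mapping.single v (Suc 0)) c"
  by (simp add: Var_def mult_single)

lemma prod_Var:
  "(\<Prod>G\<in>C. Var G :: ('v, 'b::comm_ring_1) mpoly) = Poly_Mapping.single (\<Sum>G\<in>C. Poly_Mapping.single G (Suc 0)) 1"
proof (induction C rule: infinite_finite_induct)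
  case (insert x C)
  then show ?case by (simp add: Var_def mult_single)
qed simp_all

lemma Const_add: "Const (a + b) = Const a + Const b"
  by (simp add: Const_def single_add)

lemma Const_uminus: "Const (- a) = - Const (a :: 'b::ab_group_add)"
  by (simp add: Const_def single_uminus)

lemma Const_mult: "Const (a * b) = Const a * Const (b :: 'b::comm_ring_1)"
  by (simp add: Const_def mult_single)

lemma Const_0 [simp]: "Const 0 = 0" and Const_1 [simp]: "Const 1 = 1"
  by (simp_all add: Const_def)

context loopless_matroid
begin

section \<open>The linear extension of the weight and the ideal of relations\<close>

abbreviation R :: "('a set, real) mpoly ring" where "R \<equiv> flat_ring M"
abbreviation K :: "('a set, real) mpoly set" where "K \<equiv> chow_ideal M"

definition deg_fun :: "('a set, real) mpoly \<Rightarrow> real" where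
  "deg_fun p = (\<Sum>m\<in>Poly_Mapping.keys p. Poly_Mapping.lookup p m * weight m)"

lemma deg_fun_superset:
  "finite S \<Longrightarrow> Poly_Mapping.keys p \<subseteq> S \<Longrightarrow> deg_fun p = (\<Sum>m\<in>S. Poly_Mapping.lookup p m * weight m)"
  unfolding deg_fun_def by (rule sum.mono_neutral_left) (auto simp: in_keys_iff)

lemma deg_fun_add: "deg_fun (p + q) = deg_fun p + deg_fun q"
proof -
  let ?S = "Poly_Mapping.keys p \<union> Poly_Mapping.keys q"
  have "deg_fun r = (\<Sum>m\<in>?S. Poly_Mapping.lookup r m * weight m)" if "Poly_Mapping.keys r \<subseteq> ?S" for r
    using that by (intro deg_fun_superset) auto
  then show ?thesis
    using keys_add[of p q] by (simp add: lookup_add distrib_right sum.distrib)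
qed

lemma deg_fun_0 [simp]: "deg_fun 0 = 0"
  by (simp add: deg_fun_def)

lemma deg_fun_uminus: "deg_fun (- p) = - deg_fun p"
  using deg_fun_add[of p "- p"] by simp

lemma deg_fun_diff: "deg_fun (p - q) = deg_fun p - deg_fun q"
  using deg_fun_add[of p "- q"] deg_fun_uminus[of q] by simp

lemma deg_fun_sum: "deg_fun (sum p I) = (\<Sum>i\<in>I. deg_fun (p i))"
  by (induction I rule: infinite_finite_induct) (simp_all add: deg_fun_add)

lemma deg_fun_single [simp]: "deg_fun (Poly_Mapping.single m c) = c * weight m"
  by (simp add: deg_fun_def)

lemma deg_fun_Const_mult: "deg_fun (Const c * p) = c * deg_fun p"
proof -
  have "deg_fun (Const c * p) = deg_fun (Const c * (\<Sum>m\<in>Poly_Mapping.keys p. Poly_Mapping.single m (Poly_Mapping.lookup p m)))"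
    using mpoly_eq_sum_singles[of p] by simp
  also have "\<dots> = (\<Sum>m\<in>Poly_Mapping.keys p. c * Poly_Mapping.lookup p m * weight m)"
    by (simp add: sum_distrib_left Const_mult_single deg_fun_sum)
  also have "\<dots> = c * deg_fun p"
    by (simp add: sum_distrib_left deg_fun_def mult.assoc)
  finally show ?thesis .
qed

lemma deg_fun_mult_eq_0I:
  assumes "\<And>m c. m \<in> Poly_Mapping.keys q \<Longrightarrow> deg_fun (Poly_Mapping.single m c * p) = 0"
  shows "deg_fun (q * p) = 0"
proof -
  have "deg_fun (q * p) = deg_fun ((\<Sum>m\<in>Poly_Mapping.keys q. Poly_Mapping.single m (Poly_Mapping.lookup q m)) * p)"
    using mpoly_eq_sum_singles[of q] by simp
  also have "\<dots> = 0" using assms by (simp add: sum_distrib_right deg_fun_sum)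
  finally show ?thesis .
qed

text \<open>For points of \<open>E\<close> the classes of all \<open>alpha x\<close> agree; changing
  the point in one factor of a product is the main manoeuvre in the reductions below.\<close>

definition alpha :: "'a \<Rightarrow> ('a set, real) mpoly" where
  "alpha x = (\<Sum>G | G \<in> PF \<and> x \<in> G. Var G)"

lemma alpha_carrier: "alpha x \<in> carrier R"
  unfolding alpha_def by (rule carrier_sum) (simp add: carrier_Var)

abbreviation gens_I :: "('a set, real) mpoly set" where
  "gens_I \<equiv> {Var F * Var F' | F F'. F \<in> PF \<and> F' \<in> PF \<and> \<not> F \<subseteq> F' \<and> \<not> F' \<subseteq> F}"
abbreviation gens_J :: "('a set, real) mpoly set" where
  "gens_J \<equiv> {alpha i - alpha j | i j. i \<in> E \<and> j \<in> E}"

lemma chow_I_eq: "chow_I M = genideal R gens_I" and chow_J_eq: "chow_J M = genideal R gens_J"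
  by (simp_all add: chow_I_def chow_J_def alpha_def)

lemma gens_I_carrier: "gens_I \<subseteq> carrier R"
  by (auto intro!: carrier_mult carrier_Var)

lemma gens_J_carrier: "gens_J \<subseteq> carrier R"
  by (auto intro!: carrier_diff alpha_carrier)

lemma ideal_I: "ideal (chow_I M) R" and ideal_J: "ideal (chow_J M) R" and ideal_K: "ideal K R"
proof -
  interpret cring R by (rule cring_mpoly_ring)
  show I: "ideal (chow_I M) R" unfolding chow_I_eq by (rule genideal_ideal[OF gens_I_carrier])
  show J: "ideal (chow_J M) R" unfolding chow_J_eq by (rule genideal_ideal[OF gens_J_carrier])
  show "ideal K R" unfolding chow_ideal_def by (rule add_ideals[OF I J])
qed

lemma K_iff: "p \<in> K \<longleftrightarrow> (\<exists>a\<in>chow_I M. \<exists>b\<in>chow_J M. p = a + b)"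
  by (auto simp: chow_ideal_def set_add_def' )

lemma K_add: "p \<in> K \<Longrightarrow> q \<in> K \<Longrightarrow> p + q \<in> K"
  using additive_subgroup.a_closed[OF ideal.axioms(1)[OF ideal_K], of p q] by simp

lemma K_0: "0 \<in> K"
  using additive_subgroup.zero_closed[OF ideal.axioms(1)[OF ideal_K]] by simp

lemma K_mult: "p \<in> K \<Longrightarrow> q \<in> carrier R \<Longrightarrow> q * p \<in> K"
  using ideal.I_l_closed[OF ideal_K, of p q] by simp

lemma K_uminus: "p \<in> K \<Longrightarrow> - p \<in> K"
  using K_mult[of p "- 1", OF _ carrier_uminus[OF carrier_1]] by simp

lemma K_diff: "p \<in> K \<Longrightarrow> q \<in> K \<Longrightarrow> p - q \<in> K"
  using K_add[of p "- q"] K_uminus[of q] by simp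

lemma K_sum: "(\<And>i. i \<in> I \<Longrightarrow> p i \<in> K) \<Longrightarrow> sum p I \<in> K"
  by (induction I rule: infinite_finite_induct) (simp_all add: K_0 K_add)

lemma chow_I_K: "p \<in> chow_I M \<Longrightarrow> p \<in> K"
  unfolding K_iff using additive_subgroup.zero_closed[OF ideal.axioms(1)[OF ideal_J]] by force

lemma chow_J_K: "p \<in> chow_J M \<Longrightarrow> p \<in> K"
  unfolding K_iff using additive_subgroup.zero_closed[OF ideal.axioms(1)[OF ideal_I]] by force

lemma K_incomparable:
  assumes "F \<in> PF" "G \<in> PF" "\<not> F \<subseteq> G" "\<not> G \<subseteq> F"
  shows "Var F * Var G \<in> K"
proof -
  interpret cring R by (rule cring_mpoly_ring)
  have "Var F * Var G \<in> gens_I" using assms by blast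
  then show ?thesis using genideal_self[OF gens_I_carrier] chow_I_K chow_I_eq by blast
qed

lemma K_alpha: assumes "x \<in> E" "y \<in> E" shows "alpha x - alpha y \<in> K"
proof -
  interpret cring R by (rule cring_mpoly_ring)
  have "alpha x - alpha y \<in> gens_J" using assms by blast
  then show ?thesis using genideal_self[OF gens_J_carrier] chow_J_K chow_J_eq by blast
qed

text \<open>The kernel of \<open>deg_fun\<close> need not be an ideal, so the argument passes to
  \<open>N\<close>, the polynomials all of whose multiples are killed. For generators this reduces
  to monomial multiples, where it is the vanishing of the weight off chains or the independence of
  the chosen point.\<close>

lemma deg_fun_K: assumes "p \<in> K" shows "deg_fun p = 0"
proof -
  interpret cring R by (rule cring_mpoly_ring)
  define N where "N = {p \<in> carrier R. \<forall>q\<in>carrier R. deg_fun (q * p) = 0}"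
  have sub: "subgroup N (add_monoid R)"
  proof (rule add.subgroupI)
    show "N \<subseteq> carrier R" by (auto simp: N_def)
    have "0 \<in> N" by (simp add: N_def carrier_0)
    then show "N \<noteq> {}" by blast
    fix p assume "p \<in> N"
    then have p: "p \<in> carrier R" "\<forall>q\<in>carrier R. deg_fun (q * p) = 0" by (simp_all add: N_def)
    then show "\<ominus>\<^bsub>R\<^esub> p \<in> N"
      using carrier_uminus[OF p(1)] by (simp add: N_def uminus_mpoly_ring deg_fun_uminus)
    fix q assume "q \<in> N"
    then show "p \<oplus>\<^bsub>R\<^esub> q \<in> N" using p
      by (simp add: N_def deg_fun_add distrib_left carrier_add)
  qed
  have idN: "ideal N R"
  proof (rule idealI[OF ring_axioms sub])
    fix a x assume a: "a \<in> N" and x: "x \<in> carrier R"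
    then have "deg_fun (q * (x * a)) = 0" if "q \<in> carrier R" for q
      using that carrier_mult[OF that x] by (simp add: N_def mult.assoc[symmetric])
    then have "x * a \<in> N" using a x carrier_mult[of x PF a] by (simp add: N_def)
    then show "x \<otimes>\<^bsub>R\<^esub> a \<in> N" "a \<otimes>\<^bsub>R\<^esub> x \<in> N" by (simp_all add: mult.commute)
  qed
  have "gens_I \<subseteq> N"
  proof
    fix p assume p: "p \<in> gens_I"
    then obtain F G where FG: "p = Var F * Var G" "F \<in> PF" "G \<in> PF" "\<not> F \<subseteq> G" "\<not> G \<subseteq> F" by blast
    have "deg_fun (q * p) = 0" for q
    proof (rule deg_fun_mult_eq_0I)
      fix m and c :: real
      have "weight (m + expo F + expo G) = 0"
        using FG by (auto simp: weight_def keys_add_single_nat subset_chain_def)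
      then show "deg_fun (Poly_Mapping.single m c * p) = 0"
        by (simp add: FG mult.assoc[symmetric] single_mult_Var)
    qed
    moreover have "p \<in> carrier R" using p gens_I_carrier by blast
    ultimately show "p \<in> N" by (simp add: N_def)
  qed
  then have I: "chow_I M \<subseteq> N" unfolding chow_I_eq by (rule genideal_minimal[OF idN])
  have "gens_J \<subseteq> N"
  proof
    fix p assume p: "p \<in> gens_J"
    then obtain x y where xy: "p = alpha x - alpha y" "x \<in> E" "y \<in> E" by blast
    have "deg_fun (q * p) = 0" for q
    proof (rule deg_fun_mult_eq_0I)
      fix m and c :: real
      have "deg_fun (Poly_Mapping.single m c * alpha z) = c * (\<Sum>G | G \<in> PF \<and> z \<in> G. weight (m + expo G))" for z
        by (simp add: alpha_def sum_distrib_left single_mult_Var deg_fun_sum)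
      then show "deg_fun (Poly_Mapping.single m c * p) = 0"
        using sum_weight_containing_eq[OF xy(2,3), of m] by (simp add: xy right_diff_distrib deg_fun_diff)
    qed
    moreover have "p \<in> carrier R" using p gens_J_carrier by blast
    ultimately show "p \<in> N" by (simp add: N_def)
  qed
  then have J: "chow_J M \<subseteq> N" unfolding chow_J_eq by (rule genideal_minimal[OF idN])
  have N0: "deg_fun r = 0" if "r \<in> N" for r
    using that bspec[OF _ carrier_1[of PF], of "\<lambda>q. deg_fun (q * r) = 0"] by (simp add: N_def)
  obtain a b where ab: "a \<in> chow_I M" "b \<in> chow_J M" "p = a + b" using assms K_iff by blast
  then have "a \<in> N" "b \<in> N" using I J by blast+
  then show ?thesis by (simp add: ab(3) deg_fun_add N0)
qed

section \<open>The top graded piece\<close>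

abbreviation mon :: "('a set \<Rightarrow>\<^sub>0 nat) \<Rightarrow> ('a set, real) mpoly" where
  "mon m \<equiv> Poly_Mapping.single m 1"

lemma K_cong: "p - q \<in> K \<Longrightarrow> q \<in> K \<Longrightarrow> p \<in> K"
  using K_add[of "p - q" q] by simp

text \<open>One factor \<open>alpha x\<close> is traded for \<open>alpha y\<close> with
  \<open>y\<close> outside \<open>G\<close>. Its variables are then incomparable to
  \<open>G\<close>, giving zero, or belong to strictly larger flats, where the induction hypothesis
  applies with one power less. For \<open>n = 0\<close> no proper flat has the required
  rank.\<close>

lemma alpha_power_Var_in_K:
  assumes "G \<in> PF" "Suc d \<le> n + rk M G" "x \<in> E"
  shows "alpha x ^ n * Var G \<in> K"
  using assms(1,2)
proof (induction n arbitrary: G)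
  case 0
  then show ?case using rk_flat_less[of G E] rank_eq proper_flatD[of G] by auto
next
  case (Suc n)
  obtain y where y: "y \<in> E" "y \<notin> G" using proper_flatD[OF Suc.prems(1)] by blast
  have an: "alpha x ^ n \<in> carrier R" by (rule carrier_power[OF alpha_carrier])
  have vG: "Var G \<in> carrier R" using Suc.prems by (intro carrier_Var)
  have "alpha x ^ n * Var G * (alpha x - alpha y) \<in> K"
    by (rule K_mult[OF K_alpha]) (use assms y an vG carrier_mult in auto)
  moreover have "alpha x ^ n * Var G * alpha y \<in> K"
    unfolding alpha_def[of y] sum_distrib_left
  proof (rule K_sum)
    fix F assume F: "F \<in> {F. F \<in> PF \<and> y \<in> F}"
    show "alpha x ^ n * Var G * Var F \<in> K"
    proof (cases "G \<subseteq> F")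
      case True
      then have "G \<subset> F" using F y by auto
      then have "rk M G < rk M F"
        using Suc.prems proper_flatD[of G] proper_flatD[of F] F by (intro rk_flat_less) auto
      then have "Var G * (alpha x ^ n * Var F) \<in> K" using Suc.prems F by (intro K_mult[OF Suc.IH vG]) auto
      then show ?thesis by (simp add: mult_ac)
    next
      case False
      then have "Var G * Var F \<in> K" using F y Suc.prems by (intro K_incomparable) auto
      then have "alpha x ^ n * (Var G * Var F) \<in> K" using an by (rule K_mult)
      then show ?thesis by (simp add: mult_ac)
    qed
  qed
  ultimately have "alpha x ^ n * Var G * alpha x \<in> K"
    by (intro K_cong[of "alpha x ^ n * Var G * alpha x" "alpha x ^ n * Var G * alpha y"])
      (simp_all add: right_diff_distrib)
  then show ?case by (simp add: mult_ac)
qed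

text \<open>The ranks climb strictly from 0 to d + 1 in d + 1 steps, so no value is skipped.
  Counting up gives one inequality, counting down the other.\<close>

lemma full_flag_rk:
  assumes "flag d F" "i \<le> Suc d"
  shows "rk M (F i) = i"
proof -
  have step: "rk M (F i) < rk M (F (Suc i))" if "i \<le> d" for i
    using that flag_less[OF assms(1), of i "Suc i"] flag_flat[OF assms(1), of i] flag_flat[OF assms(1), of "Suc i"]
    by (intro rk_flat_less flat_subset) auto
  have lo: "i \<le> rk M (F i)" if "i \<le> Suc d" for i
    using that
  proof (induction i)
    case (Suc i)
    then show ?case using step[of i] by auto
  qed simp
  have hi: "rk M (F i) \<le> i" if "i \<le> Suc d" for i
    using that
  proof (induction i rule: inc_induct)
    case base
    then show ?case using assms(1) rank_eq by (simp add: flag_def)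
  next
    case (step n)
    then show ?case using \<open>\<And>i. i \<le> d \<Longrightarrow> rk M (F i) < rk M (F (Suc i))\<close>[of n] by auto
  qed
  show ?thesis using lo hi assms(2) by (simp add: le_antisym)
qed

text \<open>Multiplying by \<open>\<alpha>\<close>, taken with respect to an element outside \<open>F j\<close>, extends the partial
  flag: all larger flats are killed by the remaining power of \<open>\<alpha>\<close>.\<close>

lemma alpha_power_flag:
  assumes "flag d F" "j \<le> d" "x \<in> E"
  shows "alpha x ^ d - alpha x ^ (d - j) * (\<Prod>i=1..j. Var (F i)) \<in> K"
  using assms(2)
proof (induction j)
  case 0
  then show ?case by (simp add: K_0)
next
  case (Suc j)
  let ?P = "\<Prod>i=1..j. Var (F i) :: ('a set, real) mpoly"
  let ?n = "d - Suc j"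
  have fl: "flat M (F j)" "F j \<subset> F (Suc j)" using assms(1) Suc.prems by (auto simp: flag_def)
  have F1: "F (Suc j) \<in> PF" using flag_proper[OF assms(1), of "Suc j"] Suc.prems by simp
  then obtain y where y: "y \<in> F (Suc j)" "y \<notin> F j" "y \<in> E" using fl(2) proper_flatD[OF F1] by blast
  have P: "?P \<in> carrier R" using flag_proper[OF assms(1)] Suc.prems by (intro carrier_prod carrier_Var) auto
  have an: "alpha x ^ ?n \<in> carrier R" by (rule carrier_power[OF alpha_carrier])
  let ?Q = "alpha x ^ ?n * ?P"
  have "?Q * (alpha x - alpha y) \<in> K"
    using assms(3) y an P by (intro K_mult K_alpha carrier_mult)
  moreover have "?Q * alpha y - ?Q * Var (F (Suc j)) \<in> K"
  proof -
    let ?U = "{G. G \<in> PF \<and> y \<in> G}"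
    have "?Q * alpha y - ?Q * Var (F (Suc j)) = (\<Sum>G\<in>?U - {F (Suc j)}. ?Q * Var G)"
      unfolding alpha_def[of y] sum_distrib_left using finite_PF F1 y
      by (subst sum.remove[of ?U "F (Suc j)"]) auto
    also have "\<dots> \<in> K"
    proof (rule K_sum)
      fix G assume G: "G \<in> ?U - {F (Suc j)}"
      have vG: "Var G \<in> carrier R" using G by (intro carrier_Var) auto
      show "?Q * Var G \<in> K"
      proof (cases "F j \<subseteq> G")
        case True
        have rkj: "rk M (F j) = j" using full_flag_rk[OF assms(1), of j] Suc.prems by simp
        have rkSj: "rk M (F (Suc j)) = Suc j" using full_flag_rk[OF assms(1), of "Suc j"] Suc.prems by simp
        have "rk M (F j) < rk M G"
          using True y G fl proper_flatD[of G] by (intro rk_flat_less) auto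
        \<comment> \<open>In this rank the only flat containing \<open>F j\<close> and
          \<open>y\<close> is \<open>F (Suc j)\<close>, which was set apart. So \<open>G\<close> has
          rank large enough for the remaining power of \<open>alpha x\<close> to kill it.\<close>
        moreover have "rk M G \<noteq> Suc j"
        proof
          assume "rk M G = Suc j"
          then have "G = cl (insert y (F j))"
            using rkj True y G fl by (intro eq_cl_insert) (auto simp: proper_flats_iff)
          moreover have "F (Suc j) = cl (insert y (F j))"
            using rkj rkSj y fl F1 by (intro eq_cl_insert) (auto simp: proper_flats_iff)
          ultimately have "G = F (Suc j)" by simp
          then show False using G by simp
        qed
        ultimately have "alpha x ^ ?n * Var G \<in> K"
          using G assms(3) Suc.prems rkj by (intro alpha_power_Var_in_K) auto
        then have "?P * (alpha x ^ ?n * Var G) \<in> K" using P by (rule K_mult)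
        then show ?thesis by (simp add: mult_ac)
      next
        case False
        \<comment> \<open>\<open>F 0\<close> is empty and contained in everything, so the
          incomparable flat \<open>F j\<close> really occurs as a factor of
          \<open>?P\<close>.\<close>
        then have j: "1 \<le> j" using assms(1) by (cases j) (auto simp: flag_def)
        have "Var (F j) * Var G \<in> K"
          using False G y flag_proper[OF assms(1) j] Suc.prems by (intro K_incomparable) auto
        moreover have "?P = (\<Prod>i=1..j - 1. Var (F i)) * Var (F j)"
          using j by (cases j) auto
        moreover have "(\<Prod>i=1..j - 1. Var (F i)) \<in> carrier R"
          using flag_proper[OF assms(1)] Suc.prems by (intro carrier_prod carrier_Var) auto
        ultimately show ?thesis
          using K_mult[OF \<open>Var (F j) * Var G \<in> K\<close> carrier_mult[OF an], of "\<Prod>i=1..j - 1. Var (F i)"]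
          by (simp add: mult_ac)
      qed
    qed
    finally show ?thesis .
  qed
  ultimately have "?Q * alpha x - ?Q * Var (F (Suc j)) \<in> K"
    using K_add[of "?Q * (alpha x - alpha y)" "?Q * alpha y - ?Q * Var (F (Suc j))"]
    by (simp add: right_diff_distrib)
  moreover have "?Q * alpha x = alpha x ^ (d - j) * ?P"
  proof -
    have "d - j = Suc ?n" using Suc.prems by simp
    then show ?thesis by (simp add: mult_ac)
  qed
  moreover have "?Q * Var (F (Suc j)) = alpha x ^ ?n * (\<Prod>i=1..Suc j. Var (F i))"
    by (simp add: mult_ac)
  ultimately have "alpha x ^ (d - j) * ?P - alpha x ^ ?n * (\<Prod>i=1..Suc j. Var (F i)) \<in> K"
    by (simp add: mult.assoc)
  moreover have "alpha x ^ d - alpha x ^ (d - j) * ?P \<in> K" using Suc by simp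
  ultimately show ?case
    using K_add[of "alpha x ^ d - alpha x ^ (d - j) * ?P"] by fastforce
qed

section \<open>Reducing monomials of degree d to multiples of one class\<close>

lemma cum_deg_E: "Poly_Mapping.keys m \<subseteq> PF \<Longrightarrow> cum_deg m E = (\<Sum>G\<in>Poly_Mapping.keys m. Poly_Mapping.lookup m G)"
  unfolding cum_deg_def using finite_PF proper_flatD
  by (intro sum.mono_neutral_right) (auto simp: in_keys_iff)

lemma flag_card: assumes "flag k F" shows "card (F ` {1..k}) = k"
proof -
  have "inj_on F {1..k}" by (rule inj_on_subset[OF flag_inj_on[OF assms]]) auto
  then show ?thesis by (simp add: card_image)
qed

text \<open>There are \<open>d\<close> exponents, all positive, with sum \<open>d\<close>; so all
  are 1 and the monomial is the squarefree product over the flag.\<close>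

lemma sum_ex_full_flag:
  assumes "flag d F" "Poly_Mapping.keys m = F ` {1..d}" "cum_deg m E = d"
  shows "m = (\<Sum>G\<in>F ` {1..d}. expo G)"
proof -
  have fin: "finite (F ` {1..d})" by simp
  have "F ` {1..d} \<subseteq> PF" using chain_flag[OF assms(1)] by (simp add: subset_chain_def)
  then have sd: "(\<Sum>G\<in>F ` {1..d}. Poly_Mapping.lookup m G) = (\<Sum>G\<in>F ` {1..d}. 1)"
    using cum_deg_E[of m] assms flag_card[OF assms(1)] by simp
  have ge: "1 \<le> Poly_Mapping.lookup m G" if "G \<in> F ` {1..d}" for G
    using that unfolding assms(2)[symmetric] by (simp add: in_keys_iff)
  have one: "Poly_Mapping.lookup m G = 1" if "G \<in> F ` {1..d}" for G
  proof (rule ccontr)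
    assume "Poly_Mapping.lookup m G \<noteq> 1"
    then have "(\<Sum>G\<in>F ` {1..d}. 1) < (\<Sum>G\<in>F ` {1..d}. Poly_Mapping.lookup m G)"
    proof (intro sum_strict_mono_ex1[OF fin])
      show "\<exists>G\<in>F ` {1..d}. 1 < Poly_Mapping.lookup m G"
        using ge[OF that] that \<open>Poly_Mapping.lookup m G \<noteq> 1\<close> by (intro bexI[of _ G]) auto
    qed (use ge in auto)
    then show False using sd by simp
  qed
  show ?thesis
  proof (rule poly_mapping_eqI)
    fix H
    have "Poly_Mapping.lookup (\<Sum>G\<in>F ` {1..d}. expo G) H = (if H \<in> F ` {1..d} then 1 else 0)"
      using fin by (simp add: lookup_sum lookup_single_if sum.delta)
    also have "\<dots> = Poly_Mapping.lookup m H"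
    proof (cases "H \<in> F ` {1..d}")
      case False
      then have "Poly_Mapping.lookup m H = 0" unfolding assms(2)[symmetric] by (simp add: in_keys_iff)
      then show ?thesis using False by simp
    qed (simp add: one)
    finally show "Poly_Mapping.lookup m H = Poly_Mapping.lookup (\<Sum>G\<in>F ` {1..d}. expo G) H" by simp
  qed
qed

lemma prod_Var_full_flag:
  assumes "flag d F"
  shows "(\<Prod>G\<in>F ` {1..d}. Var G :: ('a set, real) mpoly) = (\<Prod>i=1..d. Var (F i))"
proof -
  have "inj_on F {1..d}" by (rule inj_on_subset[OF flag_inj_on[OF assms]]) auto
  then show ?thesis by (simp add: prod.reindex)
qed

text \<open>One scalar serves all points \<open>x\<close>, so that no point has to be fixed while
  the reductions use different ones.\<close>

definition spanned :: "('a set, real) mpoly \<Rightarrow> bool" where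
  "spanned p \<longleftrightarrow> (\<exists>c. \<forall>x\<in>E. p - Const c * alpha x ^ d \<in> K)"

lemma spanned_K: "p \<in> K \<Longrightarrow> spanned p"
  unfolding spanned_def by (rule exI[of _ 0]) simp

lemma spanned_add: "spanned p \<Longrightarrow> spanned q \<Longrightarrow> spanned (p + q)"
proof -
  assume "spanned p" "spanned q"
  then obtain a b where ab: "\<forall>x\<in>E. p - Const a * alpha x ^ d \<in> K" "\<forall>x\<in>E. q - Const b * alpha x ^ d \<in> K"
    unfolding spanned_def by blast
  have "p + q - Const (a + b) * alpha x ^ d \<in> K" if "x \<in> E" for x
  proof -
    have "p + q - Const (a + b) * alpha x ^ d = (p - Const a * alpha x ^ d) + (q - Const b * alpha x ^ d)"
      by (simp add: Const_add algebra_simps)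
    also have "\<dots> \<in> K" using ab that by (intro K_add) simp_all
    finally show ?thesis .
  qed
  then show ?thesis unfolding spanned_def by blast
qed

lemma spanned_Const_mult: "spanned p \<Longrightarrow> spanned (Const c * p)"
proof -
  assume "spanned p"
  then obtain a where a: "\<forall>x\<in>E. p - Const a * alpha x ^ d \<in> K"
    unfolding spanned_def by blast
  have "Const c * p - Const (c * a) * alpha x ^ d \<in> K" if "x \<in> E" for x
    using K_mult[of "p - Const a * alpha x ^ d", OF _ carrier_Const[of c]] a that
    by (simp add: Const_mult right_diff_distrib mult.assoc)
  then show ?thesis unfolding spanned_def by blast
qed

lemma spanned_uminus: "spanned p \<Longrightarrow> spanned (- p)"
  using spanned_Const_mult[of p "-1"] by (simp add: Const_uminus)

lemma spanned_sum: "(\<And>i. i \<in> I \<Longrightarrow> spanned (p i)) \<Longrightarrow> spanned (sum p I)"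
  by (induction I rule: infinite_finite_induct) (simp_all add: spanned_add spanned_K K_0)

lemma mon_not_chain_in_K:
  assumes "Poly_Mapping.keys m \<subseteq> PF" "\<not> subset.chain PF (Poly_Mapping.keys m)"
  shows "mon m \<in> K"
proof -
  obtain F G where FG: "F \<in> Poly_Mapping.keys m" "G \<in> Poly_Mapping.keys m" "\<not> F \<subseteq> G" "\<not> G \<subseteq> F"
    using assms by (auto simp: subset_chain_def)
  define m' where "m' = m - expo F - expo G"
  have "m = m' + expo F + expo G"
  proof (rule poly_mapping_eqI)
    fix H
    show "Poly_Mapping.lookup m H = Poly_Mapping.lookup (m' + expo F + expo G) H"
      using FG by (auto simp: m'_def lookup_add lookup_minus lookup_single_if in_keys_iff)
  qed
  then have "mon m = mon m' * (Var F * Var G)" by (simp add: mult.assoc[symmetric] single_mult_Var)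
  moreover have "Poly_Mapping.keys m' \<subseteq> PF"
    using assms(1) by (auto simp: m'_def in_keys_iff lookup_minus)
  then have "mon m' \<in> carrier R" by (rule carrier_single)
  moreover have "Var F * Var G \<in> K" using FG assms(1) by (intro K_incomparable) auto
  ultimately show ?thesis using K_mult by simp
qed

lemma flag_length_le:
  assumes "flag k F" shows "k \<le> d"
proof -
  have "i \<le> rk M (F i)" if "i \<le> Suc k" for i
    using that
  proof (induction i)
    case (Suc i)
    have "rk M (F i) < rk M (F (Suc i))"
      using Suc flag_less[OF assms(1), of i "Suc i"] flag_flat[OF assms(1), of i] flag_flat[OF assms(1), of "Suc i"]
      by (intro rk_flat_less flat_subset) auto
    then show ?case using Suc by auto
  qed simp
  from this[of "Suc k"] show ?thesis using assms rank_eq by (simp add: flag_def)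
qed

text \<open>An exponent at least 2 at \<open>F l\<close> is lowered with the linear relation for \<open>x \<in> F l - F (l - 1)\<close> and
  \<open>y \<in> F (l + 1) - F l\<close>: every other surviving term has a larger support.\<close>

lemma spanned_mon:
  assumes "subset.chain PF (Poly_Mapping.keys m)" "cum_deg m E = d"
  shows "spanned (mon m)"
  using assms
\<comment> \<open>A chain of proper flats has at most \<open>d\<close> members, so this measures how
  far the monomial is from a squarefree one.\<close>
proof (induction "d - card (Poly_Mapping.keys m)" arbitrary: m rule: less_induct)
  case less
  obtain k F where F: "flag k F" "Poly_Mapping.keys m = F ` {1..k}"
    using ex_flag[OF less.prems(1)] by blast
  have kd: "k \<le> d" and ck: "card (Poly_Mapping.keys m) = k"
    using flag_length_le[OF F(1)] flag_card[OF F(1)] F(2) by auto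
  show ?case
  proof (cases "k = d")
    case True
    then have fF: "flag d F" and km: "Poly_Mapping.keys m = F ` {1..d}" using F by auto
    have mm: "mon m = (\<Prod>i=1..d. Var (F i))"
      using sum_ex_full_flag[OF fF km less.prems(2)] prod_Var_full_flag[OF fF] prod_Var[of "F ` {1..d}", where 'b = real]
      by simp
    have "mon m - Const 1 * alpha x ^ d \<in> K" if "x \<in> E" for x
      using K_uminus[OF alpha_power_flag[OF fF order_refl that]] by (simp add: mm)
    then show ?thesis unfolding spanned_def by blast
  next
    case False
    have "\<exists>l\<in>{1..k}. 2 \<le> Poly_Mapping.lookup m (F l)"
    proof (rule ccontr)
      assume "\<not> ?thesis"
      then have "(\<Sum>G\<in>F ` {1..k}. Poly_Mapping.lookup m G) \<le> (\<Sum>G\<in>F ` {1..k}. 1)"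
        by (intro sum_mono) force
      also have "\<dots> = k" using flag_card[OF F(1)] by simp
      finally show False
        using cum_deg_E[of m] less.prems F(2) False kd by (simp add: subset_chain_def)
    qed
    then obtain l where l: "1 \<le> l" "l \<le> k" "2 \<le> Poly_Mapping.lookup m (F l)" by auto
    define m' where "m' = m - expo (F l)"
    have m: "m = m' + expo (F l)"
    proof (rule poly_mapping_eqI)
      fix H
      show "Poly_Mapping.lookup m H = Poly_Mapping.lookup (m' + expo (F l)) H"
        using l by (auto simp: m'_def lookup_add lookup_minus lookup_single_if)
    qed
    \<comment> \<open>The exponent was at least 2, so lowering it keeps \<open>F l\<close> in the
      support.\<close>
    have km': "Poly_Mapping.keys m' = F ` {1..k}"
      unfolding F(2)[symmetric] using l by (auto simp: m'_def in_keys_iff lookup_minus lookup_single_if split: if_splits)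
    have FP: "F l \<in> PF" using flag_proper[OF F(1)] l by simp
    have cm': "Suc (cum_deg m' E) = d"
      using less.prems(2) proper_flatD[OF FP] unfolding m cum_deg_add_single[OF FP] by auto
    have ss: "F (l - 1) \<subset> F l" "F l \<subset> F (Suc l)" using flag_less[OF F(1)] l by auto
    obtain x y where xy: "x \<in> F l" "x \<notin> F (l - 1)" "y \<in> F (Suc l)" "y \<notin> F l" using ss by blast
    have xyE: "x \<in> E" "y \<in> E"
      using xy flat_subset[OF flag_flat[OF F(1)], of l] flat_subset[OF flag_flat[OF F(1)], of "Suc l"] l by auto
    have sp: "spanned (mon (m' + expo G))" if G: "G \<in> PF" "(x \<in> G) \<noteq> (y \<in> G)" "G \<noteq> F l" for G
    proof -
      have kG: "Poly_Mapping.keys (m' + expo G) = insert G (F ` {1..k})"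
        by (simp add: keys_add_single_nat km')
      show ?thesis
      proof (cases "subset.chain PF (Poly_Mapping.keys (m' + expo G))")
        case True
        \<comment> \<open>Members of the flag below \<open>F l\<close> contain neither point and
          those above contain both, so a flat separating \<open>x\<close> from \<open>y\<close> and
          different from \<open>F l\<close> enlarges the support.\<close>
        have "G \<notin> F ` {1..k}"
        proof
          assume "G \<in> F ` {1..k}"
          then obtain i where i: "G = F i" "1 \<le> i" "i \<le> k" by auto
          then have "i \<noteq> l" using G(3) by auto
          then consider "i \<le> l - 1" | "Suc l \<le> i" by linarith
          then show False
          proof cases
            case 1
            then have "F i \<subseteq> F (l - 1)" using flag_subset_iff[OF F(1), of i "l - 1"] l i by simp
            then show False using G i xy ss by auto
          next
            case 2
            then have "F (Suc l) \<subseteq> F i" using flag_subset_iff[OF F(1), of "Suc l" i] l i by simp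
            then show False using G i xy ss by auto
          qed
        qed
        then have "card (Poly_Mapping.keys (m' + expo G)) = Suc k" using flag_card[OF F(1)] by (simp add: kG)
        moreover have "cum_deg (m' + expo G) E = d" using cm' proper_flatD[OF G(1)] by (simp add: cum_deg_add_single[OF G(1)]) auto
        ultimately show ?thesis using True ck kd False by (intro less.hyps) auto
      next
        case False
        have "F ` {1..k} \<subseteq> PF" using chain_flag[OF F(1)] by (simp add: subset_chain_def)
        then show ?thesis using False G(1) by (intro spanned_K mon_not_chain_in_K) (auto simp: kG)
      qed
    qed
    let ?X = "{G. G \<in> PF \<and> x \<in> G \<and> y \<notin> G \<and> G \<noteq> F l}" and ?Y = "{G. G \<in> PF \<and> x \<notin> G \<and> y \<in> G}"
    have diff: "alpha x - alpha y = Var (F l) + (\<Sum>G\<in>?X. Var G) - (\<Sum>G\<in>?Y. Var G)"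
    proof -
      let ?B = "{G. G \<in> PF \<and> x \<in> G \<and> y \<in> G}"
      have "{G. G \<in> PF \<and> x \<in> G} = insert (F l) ?X \<union> ?B" using FP xy by auto
      then have "alpha x = (\<Sum>G\<in>insert (F l) ?X. Var G) + (\<Sum>G\<in>?B. Var G)"
        unfolding alpha_def using finite_PF xy by (subst sum.union_disjoint[symmetric]) auto
      moreover have "{G. G \<in> PF \<and> y \<in> G} = ?Y \<union> ?B" by auto
      then have "alpha y = (\<Sum>G\<in>?Y. Var G) + (\<Sum>G\<in>?B. Var G)"
        unfolding alpha_def using finite_PF by (subst sum.union_disjoint[symmetric]) auto
      moreover have "(\<Sum>G\<in>insert (F l) ?X. Var G) = Var (F l) + (\<Sum>G\<in>?X. Var G :: ('a set, real) mpoly)"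
        using finite_PF by (intro sum.insert) auto
      ultimately show ?thesis by simp
    qed
    have "mon m' \<in> carrier R"
      using chain_flag[OF F(1)] by (intro carrier_single) (simp add: km' subset_chain_def)
    then have "mon m' * (alpha x - alpha y) \<in> K" using xyE by (intro K_mult K_alpha)
    moreover have "mon m' * (alpha x - alpha y) =
      mon m + (\<Sum>G\<in>?X. mon (m' + expo G)) - (\<Sum>G\<in>?Y. mon (m' + expo G))"
      unfolding diff by (simp add: distrib_left right_diff_distrib sum_distrib_left single_mult_Var m)
    ultimately have "spanned (mon m + (\<Sum>G\<in>?X. mon (m' + expo G)) - (\<Sum>G\<in>?Y. mon (m' + expo G)))"
      using spanned_K by simp
    moreover have "spanned (\<Sum>G\<in>?X. mon (m' + expo G))" "spanned (\<Sum>G\<in>?Y. mon (m' + expo G))"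
      using sp xy by (auto intro!: spanned_sum)
    ultimately have "spanned ((mon m + (\<Sum>G\<in>?X. mon (m' + expo G)) - (\<Sum>G\<in>?Y. mon (m' + expo G)))
       + (- (\<Sum>G\<in>?X. mon (m' + expo G)) + (\<Sum>G\<in>?Y. mon (m' + expo G))))"
      by (intro spanned_add spanned_uminus)
    then show ?thesis by simp
  qed
qed

lemma spanned_homogeneous:
  assumes "p \<in> carrier R" "homogeneous d p"
  shows "spanned p"
proof -
  have "spanned (\<Sum>m\<in>Poly_Mapping.keys p. Const (Poly_Mapping.lookup p m) * mon m)"
  proof (rule spanned_sum, rule spanned_Const_mult)
    fix m assume m: "m \<in> Poly_Mapping.keys p"
    then have k: "Poly_Mapping.keys m \<subseteq> PF" using assms(1) by (simp add: carrier_mpoly_ring)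
    show "spanned (mon m)"
    proof (cases "subset.chain PF (Poly_Mapping.keys m)")
      case True
      then show ?thesis using assms(2) m cum_deg_E[OF k] by (intro spanned_mon) (auto simp: homogeneous_def)
    next
      case False
      then show ?thesis using k by (intro spanned_K mon_not_chain_in_K)
    qed
  qed
  moreover have "(\<Sum>m\<in>Poly_Mapping.keys p. Const (Poly_Mapping.lookup p m) * mon m) = p"
    using mpoly_eq_sum_singles[of p] by (simp add: Const_mult_single)
  ultimately show ?thesis by simp
qed

section \<open>The degree map\<close>

text \<open>If a rank jump exceeded 1, the closure of \<open>F i\<close> with one more point of
  \<open>F (Suc i)\<close> would fit strictly in between and enlarge the chain. With unit jumps from
  0 to d + 1 the length must be \<open>d\<close>.\<close>

lemma maxchain_flag:
  assumes "subset.maxchain PF C"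
  shows "\<exists>F. flag d F \<and> C = F ` {1..d}"
proof -
  have ch: "subset.chain PF C" and max: "\<And>S. subset.chain PF S \<Longrightarrow> \<not> C \<subset> S"
    using assms by (auto simp: pred_on.maxchain_def)
  obtain k F where F: "flag k F" "C = F ` {1..k}" using ex_flag[OF ch] by blast
  have jump: "rk M (F (Suc i)) = Suc (rk M (F i))" if i: "i \<le> k" for i
  proof (rule ccontr)
    assume ne: "rk M (F (Suc i)) \<noteq> Suc (rk M (F i))"
    have fl: "flat M (F i)" "flat M (F (Suc i))" "F i \<subset> F (Suc i)" using F(1) i by (auto simp: flag_def)
    obtain x where x: "x \<in> F (Suc i)" "x \<notin> F i" using fl(3) by blast
    have xE: "x \<in> E" using x fl flat_subset by blast
    define G where "G = cl (insert x (F i))"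
    have G1: "insert x (F i) \<subseteq> G" unfolding G_def by (rule insert_subset_cl_insert[OF fl(1) xE x(2)])
    have "G \<subseteq> F (Suc i)" unfolding G_def using x fl by (intro cl_least) auto
    moreover have "rk M G = Suc (rk M (F i))" unfolding G_def by (rule rk_cl_insert[OF fl(1) xE x(2)])
    ultimately have G2: "G \<subset> F (Suc i)" using ne by auto
    have "flat M G" unfolding G_def using xE flat_subset[OF fl(1)] by (intro flat_cl) auto
    then have GP: "G \<in> PF" using G1 G2 flat_subset[OF fl(2)] by (auto simp: proper_flats_iff)
    have FG: "F i \<subset> G" using G1 x by auto
    have cmp: "G \<subseteq> F j \<or> F j \<subseteq> G" "G \<noteq> F j" if "j \<le> k" for j
      using flag_between[OF F(1) i FG G2, of j] that by auto
    have "subset.chain PF (insert G C)"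
      using ch GP cmp unfolding subset_chain_def F(2) by fastforce
    moreover have "G \<notin> C" using cmp(2) unfolding F(2) by fastforce
    then have "C \<subset> insert G C" by blast
    ultimately show False using max by blast
  qed
  have "rk M (F i) = i" if "i \<le> Suc k" for i
    using that
  proof (induction i)
    case 0
    then show ?case using F(1) by (simp add: flag_def)
  next
    case (Suc i)
    then show ?case using jump[of i] by simp
  qed
  then have "rk M E = Suc k" using F(1) by (metis flag_def le_refl)
  then have "k = d" using rank_eq by simp
  then show ?thesis using F by blast
qed

lemma weight_factor_empty:
  assumes "flag k F" "Poly_Mapping.keys m = F ` {1..k}"
  shows "weight_factor m {} = 1"
proof -
  have "F 0 = {}" using assms(1) by (simp add: flag_def)
  moreover have "{} \<notin> Poly_Mapping.keys m"
    using chain_flag[OF assms(1)] by (auto simp: assms(2) subset_chain_def proper_flats_iff)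
  then have "Poly_Mapping.lookup m {} = 0" by (simp add: in_keys_iff)
  moreover have "cum_deg m {} = 0" using cum_deg_flag[OF assms, of 0] \<open>F 0 = {}\<close> by simp
  moreover have "mu_coeff 0 (minor M (F 1) (F 0)) = 1"
    using assms(1) by (intro mu_coeff_minor_0) (auto simp: flag_def)
  moreover have "next_flat (F ` {1..k}) (F 0) = F 1" using next_flat_flag[OF assms(1), of 0] by simp
  ultimately show ?thesis by (simp add: weight_factor_def level_def binom_def assms(2))
qed

text \<open>Here the weight takes the shape of the theorem: successors and cumulative degrees become
  indexed by the flag, and the factor of the bottom flat, being 1, drops out.\<close>

lemma weight_flag:
  assumes "flag k F" "Poly_Mapping.keys m = F ` {1..k}" "cum_deg m E = d"
  shows "weight m = (\<Prod>i=1..k. (-1) ^ (Poly_Mapping.lookup m (F i) - 1) *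
     real (binom (Poly_Mapping.lookup m (F i) - 1) (int (\<Sum>j=1..i. Poly_Mapping.lookup m (F j)) - int (rk M (F i)))) *
     of_int (mu_coeff (int (\<Sum>j=1..i. Poly_Mapping.lookup m (F j)) - int (rk M (F i))) (minor M (F (Suc i)) (F i))))"
proof -
  have "weight m = (\<Prod>G\<in>insert {} (F ` {1..k}). weight_factor m G)"
    using assms chain_flag[OF assms(1)] by (simp add: weight_def)
  also have "\<dots> = (\<Prod>j\<le>k. weight_factor m (F j))" by (rule prod_flag[OF assms(1)])
  also have "{..k} = insert 0 {1..k}" by auto
  also have "(\<Prod>j\<in>insert 0 {1..k}. weight_factor m (F j)) = (\<Prod>j=1..k. weight_factor m (F j))"
    using weight_factor_empty[OF assms(1,2)] assms(1) by (simp add: flag_def)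
  also have "\<dots> = (\<Prod>i=1..k. (-1) ^ (Poly_Mapping.lookup m (F i) - 1) *
     real (binom (Poly_Mapping.lookup m (F i) - 1) (int (\<Sum>j=1..i. Poly_Mapping.lookup m (F j)) - int (rk M (F i)))) *
     of_int (mu_coeff (int (\<Sum>j=1..i. Poly_Mapping.lookup m (F j)) - int (rk M (F i))) (minor M (F (Suc i)) (F i))))"
  proof (rule prod.cong[OF refl])
    fix i assume i: "i \<in> {1..k}"
    have "cum_deg m (F i) = (\<Sum>j=1..i. Poly_Mapping.lookup m (F j))"
      using cum_deg_flag[OF assms(1,2), of i] i by (simp add: min_def)
    moreover have "next_flat (F ` {1..k}) (F i) = F (Suc i)" using next_flat_flag[OF assms(1), of i] i by simp
    ultimately show "weight_factor m (F i) = (-1) ^ (Poly_Mapping.lookup m (F i) - 1) *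
     real (binom (Poly_Mapping.lookup m (F i) - 1) (int (\<Sum>j=1..i. Poly_Mapping.lookup m (F j)) - int (rk M (F i)))) *
     of_int (mu_coeff (int (\<Sum>j=1..i. Poly_Mapping.lookup m (F j)) - int (rk M (F i))) (minor M (F (Suc i)) (F i)))"
      by (simp only: weight_factor_def level_def assms(2))
  qed
  finally show ?thesis .
qed

lemma lookup_sum_ex: "finite C \<Longrightarrow> Poly_Mapping.lookup (\<Sum>G\<in>C. expo G) H = (if H \<in> C then 1 else 0)"
  by (simp add: lookup_sum lookup_single_if sum.delta)

text \<open>All exponents are 1 and the i-th flat has rank i, so every level is 0 and every factor
  is \<open>binom 0 0\<close> times a leading coefficient 1.\<close>

lemma deg_fun_full_flag:
  assumes "flag d F"
  shows "deg_fun (\<Prod>G\<in>F ` {1..d}. Var G) = 1"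
proof -
  let ?m = "\<Sum>G\<in>F ` {1..d}. expo G"
  have lk: "Poly_Mapping.lookup ?m H = (if H \<in> F ` {1..d} then 1 else 0)" for H
    by (rule lookup_sum_ex) simp
  have keys: "Poly_Mapping.keys ?m = F ` {1..d}"
    by (rule Set.set_eqI) (simp only: in_keys_iff lk, simp)
  have lF: "Poly_Mapping.lookup ?m (F j) = 1" if "j \<in> {1..d}" for j
    using that by (simp only: lk) auto
  have sum: "(\<Sum>j=1..i. Poly_Mapping.lookup ?m (F j)) = i" if "i \<le> d" for i
  proof -
    have "(\<Sum>j=1..i. Poly_Mapping.lookup ?m (F j)) = (\<Sum>j=1..i. 1)"
      using that by (intro sum.cong[OF refl] lF) auto
    then show ?thesis by simp
  qed
  have "F (Suc d) = E" using assms by (simp add: flag_def)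
  then have cumE: "cum_deg ?m E = d" using cum_deg_flag[OF assms keys, of "Suc d"] sum[of d] by simp
  have "weight ?m = (\<Prod>i=1..d. 1)"
    unfolding weight_flag[OF assms keys cumE]
  proof (rule prod.cong[OF refl])
    fix i assume i: "i \<in> {1..d}"
    have "mu_coeff 0 (minor M (F (Suc i)) (F i)) = 1"
      using assms i by (intro mu_coeff_minor_0) (auto simp: flag_def)
    then show "(-1) ^ (Poly_Mapping.lookup ?m (F i) - 1) *
     real (binom (Poly_Mapping.lookup ?m (F i) - 1) (int (\<Sum>j=1..i. Poly_Mapping.lookup ?m (F j)) - int (rk M (F i)))) *
     of_int (mu_coeff (int (\<Sum>j=1..i. Poly_Mapping.lookup ?m (F j)) - int (rk M (F i))) (minor M (F (Suc i)) (F i))) = 1"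
      using i full_flag_rk[OF assms, of i] sum[of i] unfolding lF[OF i] by (simp add: binom_zero del: of_nat_sum)
  qed
  then show ?thesis by (simp only: prod_Var deg_fun_single) simp
qed

lemma ex_full_flag: "\<exists>C F. subset.maxchain PF C \<and> flag d F \<and> C = F ` {1..d}"
  using subset.Hausdorff[of PF] maxchain_flag by blast

lemma deg_fun_maxchain: "subset.maxchain PF C \<Longrightarrow> deg_fun (\<Prod>G\<in>C. Var G) = 1"
  using maxchain_flag deg_fun_full_flag by blast

lemma maxchain_eq_alpha_power:
  assumes "subset.maxchain PF C" "x \<in> E"
  shows "alpha x ^ d - (\<Prod>G\<in>C. Var G) \<in> K"
proof -
  obtain F where F: "flag d F" "C = F ` {1..d}" using maxchain_flag[OF assms(1)] by blast
  show ?thesis using alpha_power_flag[OF F(1) order_refl assms(2)] prod_Var_full_flag[OF F(1)] F(2) by simp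
qed

lemma carrier_maxchain: "subset.maxchain PF C \<Longrightarrow> (\<Prod>G\<in>C. Var G) \<in> carrier R"
  by (intro carrier_prod carrier_Var) (auto simp: pred_on.maxchain_def subset_chain_def)

text \<open>Modulo the ideal \<open>p\<close> is some scalar multiple of the maximal chain, and
  \<open>deg_fun\<close> detects the scalar: it kills the ideal and is 1 on the chain.\<close>

lemma homogeneous_eq_deg_fun:
  assumes "p \<in> carrier R" "homogeneous d p" "subset.maxchain PF C"
  shows "p - Const (deg_fun p) * (\<Prod>G\<in>C. Var G) \<in> K"
proof -
  have "E \<noteq> {}" using rank_eq by auto
  then obtain x where x: "x \<in> E" by blast
  obtain c where c: "p - Const c * alpha x ^ d \<in> K"
    using spanned_homogeneous[OF assms(1,2)] x unfolding spanned_def by blast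
  have "Const c * (alpha x ^ d - (\<Prod>G\<in>C. Var G)) \<in> K"
    by (rule K_mult[OF maxchain_eq_alpha_power[OF assms(3) x] carrier_Const])
  then have k: "p - Const c * (\<Prod>G\<in>C. Var G) \<in> K"
    using K_add[OF c, of "Const c * (alpha x ^ d - (\<Prod>G\<in>C. Var G))"] by (simp add: right_diff_distrib)
  then have "deg_fun p = c"
    using deg_fun_K[OF k] deg_fun_maxchain[OF assms(3)] by (simp add: deg_fun_diff deg_fun_Const_mult)
  then show ?thesis using k by simp
qed

section \<open>Classes in the quotient ring and the degree map on them\<close>

lemma chow_class_eq_iff:
  assumes "p \<in> carrier R" "q \<in> carrier R"
  shows "chow_class M p = chow_class M q \<longleftrightarrow> p - q \<in> K"
proof -
  interpret cring R by (rule cring_mpoly_ring)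
  show ?thesis
    using quotient_eq_iff_same_a_r_cos[OF ideal_K assms] minus_mpoly_ring[OF assms(2), of p]
    by (simp add: chow_class_def)
qed

lemma chow_class_add:
  "p \<in> carrier R \<Longrightarrow> q \<in> carrier R \<Longrightarrow>
   chow_class M p \<oplus>\<^bsub>chow_ring M\<^esub> chow_class M q = chow_class M (p + q)"
  using ring_hom_add[OF ideal.rcos_ring_hom[OF ideal_K], of p q] by (simp add: chow_class_def chow_ring_def)

lemma chow_class_mult:
  "p \<in> carrier R \<Longrightarrow> q \<in> carrier R \<Longrightarrow>
   chow_class M p \<otimes>\<^bsub>chow_ring M\<^esub> chow_class M q = chow_class M (p * q)"
  using ring_hom_mult[OF ideal.rcos_ring_hom[OF ideal_K], of p q] by (simp add: chow_class_def chow_ring_def)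

lemma rank_minus_1: "rank M - 1 = d"
  by (simp add: rank_eq)

lemma homogeneous_maxchain:
  assumes "subset.maxchain PF C"
  shows "homogeneous d (Const c * (\<Prod>G\<in>C. Var G) :: ('a set, real) mpoly)"
proof -
  obtain F where F: "flag d F" "C = F ` {1..d}" using maxchain_flag[OF assms] by blast
  let ?m = "\<Sum>G\<in>C. expo G"
  have fin: "finite C" and card: "card C = d" using F flag_card[OF F(1)] by auto
  have lk: "Poly_Mapping.lookup ?m H = (if H \<in> C then 1 else 0)" for H
    by (rule lookup_sum_ex[OF fin])
  have keys: "Poly_Mapping.keys ?m = C"
    by (rule Set.set_eqI) (simp only: in_keys_iff lk, simp)
  have "(\<Sum>v\<in>Poly_Mapping.keys ?m. Poly_Mapping.lookup ?m v) = d"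
    by (simp only: keys lk) (simp add: card)
  then show ?thesis
    unfolding homogeneous_def prod_Var Const_mult_single by (metis empty_iff insert_iff keys_single)
qed

text \<open>This makes the choice in \<open>degree_map\<close> meaningful. Multiples of one maximal
  chain give surjectivity; for injectivity, polynomials with equal \<open>deg_fun\<close> are
  congruent to the same multiple of it.\<close>

lemma ex_degree_map: "\<exists>f. is_degree_map M f"
proof -
  \<comment> \<open>The value on a coset is read from an arbitrary representative, which is harmless
    because \<open>deg_fun\<close> vanishes on the ideal.\<close>
  define f where "f X = deg_fun (SOME p. p \<in> carrier R \<and> chow_class M p = X)" for X
  have f: "f (chow_class M p) = deg_fun p" if p: "p \<in> carrier R" for p
  proof -
    define q where "q = (SOME q. q \<in> carrier R \<and> chow_class M q = chow_class M p)"
    have q: "q \<in> carrier R \<and> chow_class M q = chow_class M p"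
      unfolding q_def by (rule someI[of _ p]) (simp add: p)
    then have "q - p \<in> K" using chow_class_eq_iff[of q p] p by simp
    then have "deg_fun q = deg_fun p" using deg_fun_K deg_fun_diff[of q p] by simp
    then show ?thesis by (simp add: f_def q_def)
  qed
  obtain C where C: "subset.maxchain PF C" using ex_full_flag by blast
  have "is_degree_map M f"
    unfolding is_degree_map_def rank_minus_1
  proof (intro conjI ballI allI impI)
    show "bij_betw f (chow_grade M d) UNIV"
      unfolding bij_betw_def
    proof
      show "inj_on f (chow_grade M d)"
      proof (rule inj_onI)
        fix X Y assume XY: "X \<in> chow_grade M d" "Y \<in> chow_grade M d" "f X = f Y"
        obtain p where p: "X = chow_class M p" "p \<in> carrier R" "homogeneous d p"
          using XY(1) by (auto simp: chow_grade_def)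
        obtain q where q: "Y = chow_class M q" "q \<in> carrier R" "homogeneous d q"
          using XY(2) by (auto simp: chow_grade_def)
        have "deg_fun p = deg_fun q" using XY(3) p q by (simp add: f)
        then have "p - q \<in> K"
          using K_diff[OF homogeneous_eq_deg_fun[OF p(2,3) C] homogeneous_eq_deg_fun[OF q(2,3) C]] by simp
        then show "X = Y" using chow_class_eq_iff p q by simp
      qed
      show "f ` chow_grade M d = UNIV"
      proof (intro Set.equalityI subsetI UNIV_I)
        fix c :: real
        let ?p = "Const c * (\<Prod>G\<in>C. Var G) :: ('a set, real) mpoly"
        have p: "?p \<in> carrier R" by (rule carrier_mult[OF carrier_Const carrier_maxchain[OF C]])
        then have "chow_class M ?p \<in> chow_grade M d"
          using homogeneous_maxchain[OF C] by (auto simp: chow_grade_def)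
        moreover have "f (chow_class M ?p) = c"
          using deg_fun_maxchain[OF C] by (simp add: f[OF p] deg_fun_Const_mult)
        ultimately show "c \<in> f ` chow_grade M d" by (metis image_eqI)
      qed
    qed
  next
    fix X Y assume XY: "X \<in> chow_grade M d" "Y \<in> chow_grade M d"
    obtain p where p: "X = chow_class M p" "p \<in> carrier R" using XY(1) by (auto simp: chow_grade_def)
    obtain q where q: "Y = chow_class M q" "q \<in> carrier R" using XY(2) by (auto simp: chow_grade_def)
    show "f (X \<oplus>\<^bsub>chow_ring M\<^esub> Y) = f X + f Y"
      using p q by (simp add: chow_class_add f carrier_add deg_fun_add)
  next
    fix c X assume X: "X \<in> chow_grade M d"
    obtain p where p: "X = chow_class M p" "p \<in> carrier R" using X by (auto simp: chow_grade_def)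
    show "f (chow_class M (Const c) \<otimes>\<^bsub>chow_ring M\<^esub> X) = c * f X"
      using p by (simp add: chow_class_mult carrier_Const f carrier_mult deg_fun_Const_mult)
  next
    fix C assume "subset.maxchain PF C"
    then show "f (chow_class M (\<Prod>G\<in>C. Var G)) = 1"
      using deg_fun_maxchain carrier_maxchain f by simp
  qed
  then show ?thesis by blast
qed

text \<open>Uniqueness: \<open>p\<close> is congruent to \<open>deg_fun p\<close> times a maximal
  chain, scalars pull out of any degree map, and the chain has value 1. So whichever map was chosen
  takes this value.\<close>

lemma degree_map_eq_deg_fun:
  assumes "p \<in> carrier R" "homogeneous d p"
  shows "degree_map M (chow_class M p) = deg_fun p"
proof -
  let ?f = "degree_map M"
  have f: "is_degree_map M ?f" unfolding degree_map_def using ex_degree_map by (rule someI_ex)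
  then have f1: "?f (chow_class M (\<Prod>G\<in>C. Var G)) = 1" if "subset.maxchain PF C" for C
    using that unfolding is_degree_map_def by blast
  have f2: "?f (chow_class M (Const c) \<otimes>\<^bsub>chow_ring M\<^esub> X) = c * ?f X" if "X \<in> chow_grade M d" for c X
    using f that unfolding is_degree_map_def rank_minus_1 by blast
  obtain C where C: "subset.maxchain PF C" using ex_full_flag by blast
  let ?x = "\<Prod>G\<in>C. Var G :: ('a set, real) mpoly"
  have x: "?x \<in> carrier R" by (rule carrier_maxchain[OF C])
  have "chow_class M p = chow_class M (Const (deg_fun p) * ?x)"
    using homogeneous_eq_deg_fun[OF assms C] chow_class_eq_iff[OF assms(1) carrier_mult[OF carrier_Const x]] by simp
  also have "\<dots> = chow_class M (Const (deg_fun p)) \<otimes>\<^bsub>chow_ring M\<^esub> chow_class M ?x"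
    using x by (simp add: chow_class_mult carrier_Const)
  finally have "?f (chow_class M p) = deg_fun p * ?f (chow_class M ?x)"
    using f2[of "chow_class M ?x" "deg_fun p"] x homogeneous_maxchain[OF C, of 1] by (simp add: chow_grade_def)
  then show ?thesis using f1[OF C] by simp
qed

end

section \<open>The volume polynomial\<close>

lemma lookup_single_mult_add:
  fixes P :: "('v, 'b::comm_ring_1) mpoly"
  shows "Poly_Mapping.lookup (Poly_Mapping.single k a * P) (k + m) = a * Poly_Mapping.lookup P m"
proof -
  \<comment> \<open>Inserting \<open>m\<close> keeps the term to be read off in the sum even when
    its coefficient is zero.\<close>
  have "Poly_Mapping.single k a * P =
    (\<Sum>n\<in>insert m (Poly_Mapping.keys P). Poly_Mapping.single (k + n) (a * Poly_Mapping.lookup P n))"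
    using sum_singles[of "insert m (Poly_Mapping.keys P)" P]
    by (subst (1) sum_singles[of "insert m (Poly_Mapping.keys P)" P, symmetric])
       (auto simp: sum_distrib_left mult_single simp del: sum.insert)
  then have "Poly_Mapping.lookup (Poly_Mapping.single k a * P) (k + m) =
    (\<Sum>n\<in>insert m (Poly_Mapping.keys P). if n = m then a * Poly_Mapping.lookup P n else 0)"
    by (simp add: lookup_sum lookup_single_if del: sum.insert)
  also have "\<dots> = a * Poly_Mapping.lookup P m" by (simp add: sum.delta del: sum.insert)
  finally show ?thesis .
qed

lemma lookup_single_mult_eq_0:
  fixes P :: "('v, 'b::comm_ring_1) mpoly"
  assumes "\<And>n. m \<noteq> k + n"
  shows "Poly_Mapping.lookup (Poly_Mapping.single k a * P) m = 0"
proof (rule ccontr)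
  assume "\<not> ?thesis"
  then have "m \<in> Poly_Mapping.keys (Poly_Mapping.single k a * P)" by (simp add: in_keys_iff)
  then obtain x y where "m = x + y" "x \<in> Poly_Mapping.keys (Poly_Mapping.single k a)"
    using keys_mult[of "Poly_Mapping.single k a" P] by blast
  then show False using assms by (auto split: if_splits)
qed

lemma single_sum: "Poly_Mapping.single m (sum f A) = (\<Sum>i\<in>A. Poly_Mapping.single m (f i))"
  by (induction A rule: infinite_finite_induct) (simp_all add: single_add)

text \<open>The multinomial theorem, where each outer variable comes with its inner twin; so the
  coefficient of the outer monomial \<open>m\<close> is the multinomial number times the inner
  monomial \<open>m\<close>. One factor is peeled off at a time.\<close>

lemma lookup_sum_Vars_power:
  fixes V :: "'v set"
  assumes "finite V"
  shows "Poly_Mapping.lookup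
      ((\<Sum>v\<in>V. Const (Var v) * Var v :: ('v, ('v, real) mpoly) mpoly) ^ n) m =
    (if Poly_Mapping.keys m \<subseteq> V \<and> (\<Sum>v\<in>V. Poly_Mapping.lookup m v) = n
     then Poly_Mapping.single m (fact n / (\<Prod>v\<in>V. fact (Poly_Mapping.lookup m v))) else 0)"
proof (induction n arbitrary: m)
  case 0
  have "Poly_Mapping.keys m \<subseteq> V \<and> (\<Sum>v\<in>V. Poly_Mapping.lookup m v) = 0 \<longleftrightarrow> m = 0"
  proof
    assume *: "Poly_Mapping.keys m \<subseteq> V \<and> (\<Sum>v\<in>V. Poly_Mapping.lookup m v) = 0"
    show "m = 0"
    proof (rule poly_mapping_eqI)
      fix v
      show "Poly_Mapping.lookup m v = Poly_Mapping.lookup 0 v"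
        using * assms by (cases "v \<in> V") (auto simp: in_keys_iff)
    qed
  qed simp
  then show ?case by (auto simp: lookup_one when_def)
next
  case (Suc n)
  let ?e = "\<lambda>v. Poly_Mapping.single v (Suc 0)"
  let ?S = "\<Sum>v\<in>V. Const (Var v) * Var v :: ('v, ('v, real) mpoly) mpoly"
  have split: "?e v + (m - ?e v) = m" if "v \<in> Poly_Mapping.keys m" for v
    using that by (intro poly_mapping_eqI) (auto simp: lookup_add lookup_minus lookup_single_if in_keys_iff)
  have S: "?S = (\<Sum>v\<in>V. Poly_Mapping.single (?e v) (Poly_Mapping.single (?e v) 1))"
    by (simp add: Const_def Var_def mult_single)
  have term_eq: "Poly_Mapping.lookup (Poly_Mapping.single (?e v) (Poly_Mapping.single (?e v) 1) * ?S ^ n) m =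
    (if v \<in> Poly_Mapping.keys m then Poly_Mapping.single (?e v) 1 * Poly_Mapping.lookup (?S ^ n) (m - ?e v) else 0)" for v
  proof (cases "v \<in> Poly_Mapping.keys m")
    case True
    then show ?thesis
      using lookup_single_mult_add[of "?e v" "Poly_Mapping.single (?e v) 1" "?S ^ n" "m - ?e v"] split[OF True] by simp
  next
    case False
    have "m \<noteq> ?e v + m'" for m'
      using False keys_add_single_nat[of m' v] by (auto simp: add.commute)
    then show ?thesis using False by (simp add: lookup_single_mult_eq_0)
  qed
  have "Poly_Mapping.lookup (?S ^ Suc n) m =
    (\<Sum>v\<in>V. Poly_Mapping.lookup (Poly_Mapping.single (?e v) (Poly_Mapping.single (?e v) 1) * ?S ^ n) m)"
    unfolding power_Suc by (subst (1) S) (simp add: sum_distrib_right lookup_sum)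
  also have "\<dots> = (\<Sum>v\<in>V. if v \<in> Poly_Mapping.keys m
      then Poly_Mapping.single (?e v) 1 * Poly_Mapping.lookup (?S ^ n) (m - ?e v) else 0)"
    by (simp only: term_eq)
  also have "\<dots> = (if Poly_Mapping.keys m \<subseteq> V \<and> (\<Sum>v\<in>V. Poly_Mapping.lookup m v) = Suc n
     then Poly_Mapping.single m (fact (Suc n) / (\<Prod>v\<in>V. fact (Poly_Mapping.lookup m v))) else 0)"
  proof -
    have lk: "Poly_Mapping.lookup (m - ?e v) u = (if u = v then Poly_Mapping.lookup m v - 1 else Poly_Mapping.lookup m u)" for u v
      by (simp add: lookup_minus lookup_single_if)
    have ks: "Poly_Mapping.keys (m - ?e v) \<subseteq> V \<longleftrightarrow> Poly_Mapping.keys m \<subseteq> V" if "v \<in> V" for v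
      using that by (auto simp: subset_iff in_keys_iff lk split: if_splits)
    have sm: "Suc (\<Sum>u\<in>V. Poly_Mapping.lookup (m - ?e v) u) = (\<Sum>u\<in>V. Poly_Mapping.lookup m u)"
      if "v \<in> V" "v \<in> Poly_Mapping.keys m" for v
    proof -
      have "Poly_Mapping.lookup m u = (if v = u then 1 else 0) + Poly_Mapping.lookup (m - ?e v) u" for u
        using that(2) by (simp add: lk in_keys_iff)
      then show ?thesis using that(1) assms by (simp add: sum.distrib sum.delta)
    qed
    let ?Q = "\<Prod>v\<in>V. fact (Poly_Mapping.lookup m v) :: real"
    have pr: "(\<Prod>u\<in>V. fact (Poly_Mapping.lookup (m - ?e v) u)) * real (Poly_Mapping.lookup m v) = ?Q"
      if "v \<in> V" "v \<in> Poly_Mapping.keys m" for v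
    proof -
      have "Poly_Mapping.lookup m v \<noteq> 0" using that by (simp add: in_keys_iff)
      then have f: "fact (Poly_Mapping.lookup m v - 1) * real (Poly_Mapping.lookup m v) = fact (Poly_Mapping.lookup m v)"
        by (cases "Poly_Mapping.lookup m v") (auto simp: algebra_simps)
      have "(\<Prod>u\<in>V - {v}. fact (Poly_Mapping.lookup (m - ?e v) u) :: real) = (\<Prod>u\<in>V - {v}. fact (Poly_Mapping.lookup m u))"
        by (rule prod.cong) (auto simp: lk)
      then show ?thesis
        using f assms that(1) by (simp add: prod.remove[of V v] lk mult_ac)
    qed
    show ?thesis
    proof (cases "Poly_Mapping.keys m \<subseteq> V \<and> (\<Sum>v\<in>V. Poly_Mapping.lookup m v) = Suc n")
      case True
      have "(\<Sum>v\<in>V. if v \<in> Poly_Mapping.keys m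
        then Poly_Mapping.single (?e v) 1 * Poly_Mapping.lookup (?S ^ n) (m - ?e v) else 0) =
        (\<Sum>v\<in>V. Poly_Mapping.single m (fact n * real (Poly_Mapping.lookup m v) / ?Q))"
      proof (rule sum.cong[OF refl])
        fix v assume v: "v \<in> V"
        show "(if v \<in> Poly_Mapping.keys m
          then Poly_Mapping.single (?e v) 1 * Poly_Mapping.lookup (?S ^ n) (m - ?e v) else 0) =
          Poly_Mapping.single m (fact n * real (Poly_Mapping.lookup m v) / ?Q)"
        proof (cases "v \<in> Poly_Mapping.keys m")
          case vk: True
          have nz: "real (Poly_Mapping.lookup m v) \<noteq> 0" using vk by (simp add: in_keys_iff)
          have "Poly_Mapping.lookup (?S ^ n) (m - ?e v) =
            Poly_Mapping.single (m - ?e v) (fact n / (\<Prod>u\<in>V. fact (Poly_Mapping.lookup (m - ?e v) u)))"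
            using Suc.IH[of "m - ?e v"] ks[OF v] sm[OF v vk] True by simp
          moreover have "fact n / (\<Prod>u\<in>V. fact (Poly_Mapping.lookup (m - ?e v) u)) =
            fact n * real (Poly_Mapping.lookup m v) / ?Q"
            unfolding pr[OF v vk, symmetric] using nz by simp
          ultimately show ?thesis using vk split[OF vk] by (simp add: mult_single)
        next
          case False
          then show ?thesis by (simp add: in_keys_iff)
        qed
      qed
      also have "\<dots> = Poly_Mapping.single m (\<Sum>v\<in>V. fact n * real (Poly_Mapping.lookup m v) / ?Q)"
        by (rule single_sum[symmetric])
      \<comment> \<open>The recursion of multinomial coefficients: the numerators carry the
        exponents of \<open>m\<close>, whose total is n + 1.\<close>
      also have "(\<Sum>v\<in>V. fact n * real (Poly_Mapping.lookup m v) / ?Q) = fact (Suc n) / ?Q"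
      proof -
        have "(\<Sum>v\<in>V. fact n * real (Poly_Mapping.lookup m v) / ?Q) = fact n * real (\<Sum>v\<in>V. Poly_Mapping.lookup m v) / ?Q"
          by (simp add: sum_distrib_left sum_divide_distrib)
        then show ?thesis using True by (simp add: mult.commute)
      qed
      finally show ?thesis using True by simp
    next
      case False
      have "(if v \<in> Poly_Mapping.keys m
          then Poly_Mapping.single (?e v) 1 * Poly_Mapping.lookup (?S ^ n) (m - ?e v) else 0) = 0" if v: "v \<in> V" for v
        using Suc.IH[of "m - ?e v"] ks[OF v] sm[OF v] False by auto
      then show ?thesis unfolding if_not_P[OF False] by (intro sum.neutral ballI)
    qed
  qed
  finally show ?case .
qed

theorem corollary3p3:
  fixes M :: "'a pre_matroid" and F :: "nat \<Rightarrow> 'a set" and d k :: nat and ds :: "nat \<Rightarrow> nat"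
  assumes "matroid M" and "loopless M" and "rank M = d + 1"
    and "F 0 = {}" and "F (k + 1) = ground M"
    and "\<forall>i\<le>k + 1. flat M (F i)" and "\<forall>i\<le>k. F i \<subset> F (i + 1)"
    and "\<forall>i\<in>{1..k}. 0 < ds i" and "(\<Sum>i=1..k. ds i) = d"
  shows "Poly_Mapping.lookup (volume_poly M) (\<Sum>i=1..k. Poly_Mapping.single (F i) (ds i)) =
    (-1) ^ (d - k) * (fact d / (\<Prod>i=1..k. fact (ds i))) *
    (\<Prod>i=1..k.
       real (binom (ds i - 1) ((\<Sum>j=1..i. int (ds j)) - int (rk M (F i)))) *
       of_int (mu_coeff ((\<Sum>j=1..i. int (ds j)) - int (rk M (F i))) (minor M (F (i + 1)) (F i))))"
proof -
  interpret matroid M by fact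
  interpret loopless_matroid M d
    using assms(2,3) by unfold_locales (simp_all add: loopless_def)
  have F: "flag k F" using assms(4-7) by (simp add: flag_def)
  define m where "m = (\<Sum>i=1..k. Poly_Mapping.single (F i) (ds i))"
  have inj: "inj_on F {1..k}" by (rule inj_on_subset[OF flag_inj_on[OF F]]) auto
  have lk: "Poly_Mapping.lookup m (F i) = ds i" if i: "i \<in> {1..k}" for i
  proof -
    have "Poly_Mapping.lookup m (F i) = (\<Sum>j=1..k. if j = i then ds j else 0)"
      unfolding m_def lookup_sum lookup_single_if using inj i
      by (intro sum.cong) (auto simp: inj_on_eq_iff)
    then show ?thesis using i by (simp add: sum.delta)
  qed
  have lk0: "Poly_Mapping.lookup m G = 0" if "G \<notin> F ` {1..k}" for G
    unfolding m_def lookup_sum lookup_single_if using that by (intro sum.neutral) auto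
  have keys: "Poly_Mapping.keys m = F ` {1..k}"
  proof (intro Set.equalityI subsetI)
    fix G assume "G \<in> Poly_Mapping.keys m"
    then show "G \<in> F ` {1..k}" using lk0[of G] by (auto simp: in_keys_iff)
  next
    fix G assume "G \<in> F ` {1..k}"
    then obtain i where i: "i \<in> {1..k}" "G = F i" by blast
    then have "Poly_Mapping.lookup m G \<noteq> 0" using lk[OF i(1)] assms(8) by auto
    then show "G \<in> Poly_Mapping.keys m" by (simp add: in_keys_iff)
  qed
  have kP: "Poly_Mapping.keys m \<subseteq> PF" using chain_flag[OF F] keys by (simp add: subset_chain_def)
  have sums: "(\<Sum>j=1..i. Poly_Mapping.lookup m (F j)) = (\<Sum>j=1..i. ds j)" if "i \<le> k" for i
    using that by (intro sum.cong[OF refl] lk) auto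
  have deg: "(\<Sum>G\<in>Poly_Mapping.keys m. Poly_Mapping.lookup m G) = d"
    unfolding keys sum.reindex[OF inj] using sums[of k] assms(9) by simp
  have sumPF: "(\<Sum>G\<in>PF. Poly_Mapping.lookup m G) = d"
    unfolding deg[symmetric] using kP finite_PF by (intro sum.mono_neutral_right) (auto simp: in_keys_iff)
  have prodPF: "(\<Prod>G\<in>PF. fact (Poly_Mapping.lookup m G)) = (\<Prod>i=1..k. fact (ds i) :: real)"
  proof -
    have "(\<Prod>G\<in>PF. fact (Poly_Mapping.lookup m G)) = (\<Prod>G\<in>F ` {1..k}. fact (Poly_Mapping.lookup m G) :: real)"
      unfolding keys[symmetric] using kP finite_PF by (intro prod.mono_neutral_right) (auto simp: in_keys_iff)
    also have "\<dots> = (\<Prod>i=1..k. fact (ds i))"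
      unfolding prod.reindex[OF inj] using lk by (intro prod.cong) auto
    finally show ?thesis .
  qed
  let ?c = "fact d / (\<Prod>i=1..k. fact (ds i)) :: real"
  \<comment> \<open>\<open>Poly_Mapping.map\<close> keeps zero coefficients at zero without applying
    the function, so the coefficient must be known to be nonzero before the degree map can be
    evaluated on it.\<close>
  have "Poly_Mapping.lookup (Poly_Mapping.single m ?c) m \<noteq> 0" by simp
  then have nz: "Poly_Mapping.single m ?c \<noteq> 0" by (intro notI) (simp only: lookup_zero)
  have coeff: "Poly_Mapping.lookup ((\<Sum>F\<in>PF. Const (Var F) * Var F :: ('a set, ('a set, real) mpoly) mpoly) ^ d) m
      = Poly_Mapping.single m ?c"
    unfolding lookup_sum_Vars_power[OF finite_PF] using kP sumPF prodPF by simp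
  have "Poly_Mapping.lookup (volume_poly M) m = degree_map M (chow_class M (Poly_Mapping.single m ?c))"
    unfolding volume_poly_def rank_minus_1 map.rep_eq coeff using nz by (simp only: when_def) simp
  also have "\<dots> = ?c * weight m"
    using kP deg by (subst degree_map_eq_deg_fun) (auto simp: carrier_single homogeneous_def)
  also have "weight m = (\<Prod>i=1..k. (-1) ^ (ds i - 1) * (real (binom (ds i - 1) ((\<Sum>j=1..i. int (ds j)) - int (rk M (F i)))) *
       of_int (mu_coeff ((\<Sum>j=1..i. int (ds j)) - int (rk M (F i))) (minor M (F (i + 1)) (F i)))))"
  proof -
    have cE: "cum_deg m E = d" using cum_deg_E[OF kP] deg by simp
    show ?thesis unfolding weight_flag[OF F keys cE]
    proof (rule prod.cong[OF refl])
      fix i assume i: "i \<in> {1..k}"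
      then have s: "(\<Sum>j=1..i. Poly_Mapping.lookup m (F j)) = (\<Sum>j=1..i. ds j)" by (intro sums) simp
      show "(-1) ^ (Poly_Mapping.lookup m (F i) - 1) *
     real (binom (Poly_Mapping.lookup m (F i) - 1) (int (\<Sum>j=1..i. Poly_Mapping.lookup m (F j)) - int (rk M (F i)))) *
     of_int (mu_coeff (int (\<Sum>j=1..i. Poly_Mapping.lookup m (F j)) - int (rk M (F i))) (minor M (F (Suc i)) (F i))) =
     (-1) ^ (ds i - 1) * (real (binom (ds i - 1) ((\<Sum>j=1..i. int (ds j)) - int (rk M (F i)))) *
       of_int (mu_coeff ((\<Sum>j=1..i. int (ds j)) - int (rk M (F i))) (minor M (F (i + 1)) (F i))))"
        unfolding s lk[OF i] by simp
    qed
  qed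
  also have "\<dots> = (-1) ^ (d - k) * (\<Prod>i=1..k. real (binom (ds i - 1) ((\<Sum>j=1..i. int (ds j)) - int (rk M (F i)))) *
       of_int (mu_coeff ((\<Sum>j=1..i. int (ds j)) - int (rk M (F i))) (minor M (F (i + 1)) (F i))))"
  proof -
    \<comment> \<open>Positivity of the \<open>ds i\<close> keeps the truncated differences exact;
      they add up to \<open>d - k\<close>, which collects the signs of the factors.\<close>
    have "(\<Sum>i=1..k. ds i) = (\<Sum>i=1..k. (ds i - 1) + 1)" using assms(8) by (intro sum.cong) auto
    then have "d - k = (\<Sum>i=1..k. ds i - 1)" using assms(9) by (simp only: sum.distrib) simp
    then have "(\<Prod>i=1..k. (-1::real) ^ (ds i - 1)) = (-1) ^ (d - k)" by (simp add: power_sum)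
    then show ?thesis by (simp only: prod.distrib)
  qed
  finally show ?thesis by (simp only: m_def mult_ac)
qed

end
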